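(* Fix positive integers $d_1,d_2,t$ and $0<\beta<1$. Let $P$ be a set of $m$ points in $\mathbb{R}^{d_1}$ and $Q$ a set of $n$ points in $\mathbb{R}^{d_2}$, and let $G=(P,Q)$ be a bipartite semi-algebraic graph with description complexity $t$. If $G$ is $\beta$-nondegenerate, then $G$ has at most $C(mn^{1-1/d_2}+n)$ edges, where $C$ depends only on $\beta,d_1,d_2,t$.
   Context: $G=(P,Q)$ is semi-algebraic with description complexity $t$ if there are polynomials $f_1,\dots,f_t\in\mathbb{R}[x_1,\dots,x_{d_1+d_2}]$, each of degree at most $t$, and a Boolean function $\Phi(X_1,\dots,X_t)$ such that for all $p\in P,q\in Q$: $(p,q)$ is an edge iff $\Phi(f_1(p,q)\ge0,\dots,f_t(p,q)\ge0)=1$. With $N(q)\subseteq P$ the neighborhood of $q\in Q$, $G$ is $\beta$-nondegenerate if $|N(q)\cap N(q')|<\beta|N(q)|$ for all distinct $q,q'\in Q$. *)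

theory Defs
  imports "HOL-Analysis.Analysis" "HOL-Library.Poly_Mapping"
begin

text \<open>Real polynomials in variables indexed by \<open>'n\<close>: finitely supported maps
  from exponent vectors to coefficients.\<close>

type_synonym 'n real_mpoly = "('n \<Rightarrow>\<^sub>0 nat) \<Rightarrow>\<^sub>0 real"

definition eval_mpoly :: "'n::finite real_mpoly \<Rightarrow> real ^ 'n \<Rightarrow> real" where
  "eval_mpoly f x =
     (\<Sum>a\<in>Poly_Mapping.keys f. Poly_Mapping.lookup f a * (\<Prod>i\<in>UNIV. (x $ i) ^ Poly_Mapping.lookup a i))"

text \<open>Total degree at most \<open>t\<close>; the zero polynomial satisfies this for every \<open>t\<close>.\<close>

definition degree_at_most :: "nat \<Rightarrow> 'n::finite real_mpoly \<Rightarrow> bool" where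
  "degree_at_most t f \<longleftrightarrow>
     (\<forall>a\<in>Poly_Mapping.keys f. (\<Sum>i\<in>UNIV. Poly_Mapping.lookup a i) \<le> t)"

definition join_point :: "real ^ 'd1 \<Rightarrow> real ^ 'd2 \<Rightarrow> real ^ ('d1::finite + 'd2::finite)" where
  "join_point p q = (\<chi> k. case k of Inl i \<Rightarrow> p $ i | Inr j \<Rightarrow> q $ j)"

text \<open>A bipartite graph with parts \<open>P\<close> and \<open>Q\<close> is given by its set
  \<open>E \<subseteq> P \<times> Q\<close> of edges, so the two parts count as disjoint even
  if they lie in the same space. The Boolean function \<open>\<Phi>\<close> only ever receives lists of
  length \<open>t\<close>.\<close>

definition semi_algebraic_graph ::
    "nat \<Rightarrow> (real ^ 'd1::finite) set \<Rightarrow> (real ^ 'd2::finite) set \<Rightarrow> ((real ^ 'd1) \<times> (real ^ 'd2)) set \<Rightarrow> bool" where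
  "semi_algebraic_graph t P Q E \<longleftrightarrow>
     (\<exists>(fs :: ('d1 + 'd2) real_mpoly list) (\<Phi> :: bool list \<Rightarrow> bool).
        length fs = t \<and> (\<forall>f\<in>set fs. degree_at_most t f) \<and>
        (\<forall>p\<in>P. \<forall>q\<in>Q. (p, q) \<in> E \<longleftrightarrow> \<Phi> (map (\<lambda>f. eval_mpoly f (join_point p q) \<ge> 0) fs)))"

definition neighborhood :: "('a \<times> 'b) set \<Rightarrow> 'b \<Rightarrow> 'a set" where
  "neighborhood E q = {p. (p, q) \<in> E}"

definition nondegenerate :: "real \<Rightarrow> 'b set \<Rightarrow> ('a \<times> 'b) set \<Rightarrow> bool" where
  "nondegenerate \<beta> Q E \<longleftrightarrow>
     (\<forall>q\<in>Q. \<forall>q'\<in>Q. q \<noteq> q' \<longrightarrow>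
        real (card (neighborhood E q \<inter> neighborhood E q')) < \<beta> * real (card (neighborhood E q)))"

end

theory Submission
  imports Defs
begin

text \<open>Writing \<open>d = CARD('d2)\<close>, the sets \<open>N q = neighborhood E q\<close> have polynomially few traces: by
  Warren's bound on sign patterns, at most \<open>A * s ^ d\<close> distinct traces on any \<open>s\<close> points of \<open>P\<close>.
  Nondegeneracy says that they are separated: \<open>(1 - \<beta>) * card (N q) \<le> card (N q - N q')\<close>.

  For \<open>d \<ge> 2\<close>, Haussler's packing argument in the form of Chazelle produces a set \<open>S\<close> of about
  \<open>n powr (1 / d)\<close> points such that the \<open>q\<close> sharing their trace on \<open>S\<close> with another point of \<open>Q\<close>
  contribute only \<open>O(m * n powr (1 - 1 / d))\<close> edges, while at most \<open>n / 2\<close> points remain. Iterating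
  on these gives a geometric series. For \<open>d = 1\<close> that series would cost a logarithm; instead, order \<open>Q\<close>
  on the line and charge \<open>N q\<close> to its difference with the next set, since each \<open>p\<close> leaves the sets
  only boundedly often along the line.\<close>

section \<open>Polynomial functions of bounded degree\<close>

text \<open>An inductive predicate on functions, so that closure properties are rule inductions
  without coefficients. As \<open>const\<close> holds at every \<open>k\<close>, the index is an
  upper bound for the degree.\<close>

inductive polyfun_le :: "nat \<Rightarrow> (real ^ 'n \<Rightarrow> real) \<Rightarrow> bool" where
  const: "polyfun_le k (\<lambda>x. c)"
| var_mult: "polyfun_le k f \<Longrightarrow> polyfun_le (Suc k) (\<lambda>x. x $ i * f x)"
| add: "polyfun_le k f \<Longrightarrow> polyfun_le k g \<Longrightarrow> polyfun_le k (\<lambda>x. f x + g x)"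

lemma polyfun_le_Suc: "polyfun_le k f \<Longrightarrow> polyfun_le (Suc k) f"
  by (induction rule: polyfun_le.induct) (auto intro: polyfun_le.intros)

lemma polyfun_le_mono: "polyfun_le k f \<Longrightarrow> k \<le> l \<Longrightarrow> polyfun_le l f"
  by (induction l) (auto simp: le_Suc_eq intro: polyfun_le_Suc)

lemma polyfun_le_cmult: "polyfun_le k f \<Longrightarrow> polyfun_le k (\<lambda>x. c * f x)"
proof (induction rule: polyfun_le.induct)
  case (var_mult k f i)
  then show ?case using polyfun_le.var_mult[of k "\<lambda>x. c * f x" i] by (simp add: mult.left_commute)
qed (auto simp: distrib_left intro: polyfun_le.intros)

lemma polyfun_le_uminus: "polyfun_le k f \<Longrightarrow> polyfun_le k (\<lambda>x. - f x)"
  using polyfun_le_cmult[of k f "-1"] by simp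

lemma polyfun_le_mult: "polyfun_le j f \<Longrightarrow> polyfun_le k g \<Longrightarrow> polyfun_le (j + k) (\<lambda>x. f x * g x)"
proof (induction rule: polyfun_le.induct)
  case (const j c)
  then show ?case using polyfun_le_mono[OF polyfun_le_cmult] by fastforce
next
  case (var_mult j f i)
  then show ?case using polyfun_le.var_mult[of "j + k" "\<lambda>x. f x * g x" i] by (simp add: mult.assoc)
qed (auto simp: distrib_right intro: polyfun_le.intros)

lemma polyfun_le_nth: "polyfun_le 1 (\<lambda>x. x $ i)"
  using polyfun_le.var_mult[OF polyfun_le.const[of 0 1], of i] by simp

lemma polyfun_le_power: "polyfun_le k f \<Longrightarrow> polyfun_le (n * k) (\<lambda>x. f x ^ n)"
  by (induction n) (auto intro: polyfun_le.const polyfun_le_mult)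

lemma polyfun_le_sum:
  assumes "\<And>i. i \<in> I \<Longrightarrow> polyfun_le k (f i)"
  shows "polyfun_le k (\<lambda>x. \<Sum>i\<in>I. f i x)"
  using assms by (induction I rule: infinite_finite_induct) (auto intro: polyfun_le.intros)

lemma polyfun_le_prod:
  assumes "\<And>i. i \<in> I \<Longrightarrow> polyfun_le (k i) (f i)"
  shows "polyfun_le (\<Sum>i\<in>I. k i) (\<lambda>x. \<Prod>i\<in>I. f i x)"
  using assms by (induction I rule: infinite_finite_induct) (auto intro: polyfun_le.const polyfun_le_mult)

lemma continuous_on_polyfun_le: "polyfun_le k f \<Longrightarrow> continuous_on S f"
  by (induction rule: polyfun_le.induct) (auto intro!: continuous_intros)

text \<open>Serves the coercivity argument in \<open>exists_critical_point\<close>. The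
  \<open>max 1\<close> keeps the bound valid near the origin, where powers of the norm
  vanish.\<close>

lemma polyfun_le_growth:
  assumes "polyfun_le k f"
  obtains C where "C > 0" "\<And>x. \<bar>f x\<bar> \<le> C * max 1 (infnorm x) ^ k"
proof -
  have "\<exists>C>0. \<forall>x. \<bar>f x\<bar> \<le> C * max 1 (infnorm x) ^ k"
    using assms
  proof (induction rule: polyfun_le.induct)
    case (const k c)
    have "\<bar>c\<bar> \<le> (\<bar>c\<bar> + 1) * max 1 (infnorm x) ^ k" for x :: "real ^ 'a"
      using mult_left_mono[OF one_le_power[of "max 1 (infnorm x)" k], of "\<bar>c\<bar> + 1"] by simp
    then show ?case by (intro exI[of _ "\<bar>c\<bar> + 1"]) auto
  next
    case (var_mult k f i)
    then obtain C where C: "C > 0" "\<And>x. \<bar>f x\<bar> \<le> C * max 1 (infnorm x) ^ k" by blast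
    have "\<bar>x $ i * f x\<bar> \<le> max 1 (infnorm x) * (C * max 1 (infnorm x) ^ k)" for x
      unfolding abs_mult using component_le_infnorm_cart[of x i] C(2)[of x]
      by (intro mult_mono) auto
    then show ?case using C(1) by (intro exI[of _ C]) (auto simp: mult.left_commute)
  next
    case (add k f g)
    then obtain C D where "C > 0" "D > 0" "\<And>x. \<bar>f x\<bar> \<le> C * max 1 (infnorm x) ^ k"
      "\<And>x. \<bar>g x\<bar> \<le> D * max 1 (infnorm x) ^ k" by blast
    then show ?case
      by (intro exI[of _ "C + D"]) (auto simp: distrib_right intro: order_trans[OF abs_triangle_ineq] add_mono)
  qed
  then show ?thesis using that by blast
qed

lemma polyfun_le_partial_derivative:
  assumes "polyfun_le k f"
  obtains f' where "polyfun_le k f'"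
    "\<And>x. ((\<lambda>s. f (x + s *\<^sub>R axis i 1)) has_real_derivative f' x) (at 0)"
proof -
  have "\<exists>f'. polyfun_le k f' \<and> (\<forall>x. ((\<lambda>s. f (x + s *\<^sub>R axis i 1)) has_real_derivative f' x) (at 0))"
    using assms
  proof (induction rule: polyfun_le.induct)
    case (const k c)
    show ?case by (intro exI[of _ "\<lambda>x. 0"]) (auto intro: polyfun_le.const)
  next
    case (var_mult k f j)
    then obtain f' where f': "polyfun_le k f'"
      "\<And>x. ((\<lambda>s. f (x + s *\<^sub>R axis i 1)) has_real_derivative f' x) (at 0)" by blast
    have "((\<lambda>s. (x + s *\<^sub>R axis i 1) $ j) has_real_derivative axis i 1 $ j) (at 0)" for x :: "real ^ 'a"
      by (auto intro!: derivative_eq_intros)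
    from DERIV_mult[OF this f'(2)]
    have "((\<lambda>s. (x + s *\<^sub>R axis i 1) $ j * f (x + s *\<^sub>R axis i 1)) has_real_derivative
        axis i 1 $ j * f x + x $ j * f' x) (at 0)" for x
      by (simp add: mult.commute)
    moreover have "polyfun_le (Suc k) (\<lambda>x. axis i 1 $ j * f x + x $ j * f' x)"
      using var_mult.hyps f'(1) by (intro polyfun_le.add polyfun_le_Suc[OF polyfun_le_cmult] polyfun_le.var_mult)
    ultimately show ?case by blast
  next
    case (add k f g)
    then obtain f' g' where "polyfun_le k f'" "polyfun_le k g'"
      "\<And>x. ((\<lambda>s. f (x + s *\<^sub>R axis i 1)) has_real_derivative f' x) (at 0)"
      "\<And>x. ((\<lambda>s. g (x + s *\<^sub>R axis i 1)) has_real_derivative g' x) (at 0)" by blast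
    then show ?case by (intro exI[of _ "\<lambda>x. f' x + g' x"]) (auto intro: polyfun_le.add DERIV_add)
  qed
  then show ?thesis using that by blast
qed

lemma polyfun_le_eval_mpoly:
  assumes "degree_at_most t f"
  shows "polyfun_le t (\<lambda>q. eval_mpoly f (join_point p q))"
proof -
  have "polyfun_le (Poly_Mapping.lookup a i) (\<lambda>q. (join_point p q $ i) ^ Poly_Mapping.lookup a i)"
    for a and i :: "'a + 'b"
    using polyfun_le_power[OF polyfun_le_nth, of "Poly_Mapping.lookup a i"]
    by (cases i) (auto simp: join_point_def intro: polyfun_le.const)
  then have "polyfun_le (\<Sum>i\<in>UNIV. Poly_Mapping.lookup a i)
      (\<lambda>q. \<Prod>i\<in>UNIV. (join_point p q $ i) ^ Poly_Mapping.lookup a i)" for a :: "'a + 'b \<Rightarrow>\<^sub>0 nat"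
    by (rule polyfun_le_prod)
  then show ?thesis
    unfolding eval_mpoly_def using assms
    by (intro polyfun_le_sum polyfun_le_cmult) (auto simp: degree_at_most_def intro: polyfun_le_mono)
qed

section \<open>Linear dependencies and the number of common zeros\<close>

lemma homogeneous_system_nontrivial_solution:
  fixes M :: "'b \<Rightarrow> 'z \<Rightarrow> real"
  assumes "finite B" "finite Z" "card B < card Z"
  shows "\<exists>l. (\<exists>z\<in>Z. l z \<noteq> 0) \<and> (\<forall>b\<in>B. (\<Sum>z\<in>Z. l z * M b z) = 0)"
  using assms
proof (induction B arbitrary: Z M rule: finite_induct)
  case empty
  then have "Z \<noteq> {}" by auto
  then show ?case by (intro exI[of _ "\<lambda>_. 1"]) auto
next
  case (insert b B)
  show ?case
  proof (cases "\<exists>w\<in>Z. M b w \<noteq> 0")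
    case False
    then show ?thesis using insert.IH[of Z M] insert by auto
  next
    case True
    \<comment> \<open>Gaussian elimination: \<open>w\<close> is a pivot for equation
      \<open>b\<close>, and the induction hypothesis gets the other equations with the unknown at
      \<open>w\<close> eliminated.\<close>
    then obtain w where w: "w \<in> Z" "M b w \<noteq> 0" by blast
    define Y where "Y = Z - {w}"
    have Y: "finite Y" "Z = insert w Y" "w \<notin> Y" using w insert.prems by (auto simp: Y_def)
    then have "card B < card Y" using insert by simp
    from insert.IH[OF \<open>finite Y\<close> this, of "\<lambda>b' z. M b' z - M b' w * M b z / M b w"]
    obtain l where l: "\<exists>z\<in>Y. l z \<noteq> 0"
      "\<And>b'. b' \<in> B \<Longrightarrow> (\<Sum>z\<in>Y. l z * (M b' z - M b' w * M b z / M b w)) = 0" by blast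
    \<comment> \<open>The value at \<open>w\<close> is the one forced by equation
      \<open>b\<close>.\<close>
    define l' where "l' = l(w := - (\<Sum>z\<in>Y. l z * M b z) / M b w)"
    have *: "(\<Sum>z\<in>Z. l' z * M b' z) = l' w * M b' w + (\<Sum>z\<in>Y. l z * M b' z)" for b'
      using Y by (auto simp: l'_def intro!: sum.cong)
    have "(\<Sum>z\<in>Z. l' z * M b z) = 0" unfolding * using w by (simp add: l'_def)
    moreover have "(\<Sum>z\<in>Z. l' z * M b' z) = 0" if "b' \<in> B" for b'
    proof -
      have "(\<Sum>z\<in>Y. l z * M b' z) = (\<Sum>z\<in>Y. l z * M b z) * M b' w / M b w"
        using l(2)[OF that]
        by (simp add: right_diff_distrib sum_subtractf sum_distrib_left sum_divide_distrib sum_distrib_right ac_simps)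
      then show ?thesis unfolding * by (simp add: l'_def)
    qed
    moreover have "\<exists>z\<in>Z. l' z \<noteq> 0" using l(1) Y by (auto simp: l'_def)
    ultimately show ?thesis by blast
  qed
qed

definition monom_fun :: "('n \<Rightarrow> nat) \<Rightarrow> real ^ 'n \<Rightarrow> real" where
  "monom_fun a x = (\<Prod>i\<in>UNIV. (x $ i) ^ a i)"

lemma monom_fun_upd:
  fixes a :: "'n::finite \<Rightarrow> nat"
  shows "monom_fun (a(i := a i + k)) x = monom_fun a x * (x $ i) ^ k"
proof -
  have "monom_fun (a(i := a i + k)) x = (\<Prod>j\<in>UNIV. (x $ j) ^ a j * (if j = i then (x $ i) ^ k else 1))"
    unfolding monom_fun_def by (intro prod.cong) (auto simp: power_add)
  then show ?thesis by (simp add: prod.distrib prod.delta monom_fun_def)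
qed

lemma sum_fun_upd_add:
  fixes a :: "'n::finite \<Rightarrow> nat"
  shows "(\<Sum>j\<in>UNIV. (a(i := a i + k)) j) = (\<Sum>j\<in>UNIV. a j) + k"
proof -
  have "(\<Sum>j\<in>UNIV. (a(i := a i + k)) j) = (\<Sum>j\<in>UNIV. a j + (if j = i then k else 0))"
    by (intro sum.cong) auto
  then show ?thesis by (simp add: sum.distrib sum.delta)
qed

text \<open>\<open>l\<close> is read as the linear functional taking a function to its weighted sum
  over \<open>Z\<close>; \<open>f\<close> is built from monomials of degree at most
  \<open>j\<close>. Generalizing over \<open>b\<close> lets the induction absorb each factor
  \<open>x $ i\<close> into the monomial.\<close>

lemma polyfun_le_functional_eq_0:
  fixes l :: "real ^ 'n \<Rightarrow> real"
  assumes "polyfun_le j f"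
    and "\<And>a. (\<Sum>i\<in>UNIV. a i) \<le> (\<Sum>i\<in>UNIV. b i) + j \<Longrightarrow> (\<Sum>z\<in>Z. l z * monom_fun a z) = 0"
  shows "(\<Sum>z\<in>Z. l z * (monom_fun b z * f z)) = 0"
  using assms
proof (induction arbitrary: b rule: polyfun_le.induct)
  case (const k c)
  from const[of b] show ?case
    by (simp add: sum_distrib_right[symmetric] mult.assoc[symmetric])
next
  case (var_mult k f i)
  have "(\<Sum>z\<in>Z. l z * (monom_fun (b(i := b i + 1)) z * f z)) = 0"
    by (rule var_mult.IH, rule var_mult.prems) (use sum_fun_upd_add[of b i 1] in simp)
  then show ?case unfolding monom_fun_upd by (simp add: mult.assoc)
next
  case (add k f g)
  from add.IH[of b] add.prems show ?case by (simp add: distrib_left sum.distrib)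
qed

text \<open>A weak form of Bezout's theorem. The monomials with all exponents at most \<open>d\<close>
  span all functions on \<open>Z\<close>, because the equations rewrite every other monomial into monomials
  of smaller total degree.\<close>

lemma card_common_zeros_le:
  fixes Z :: "(real ^ 'n) set"
  assumes fin: "finite Z"
    and g: "\<And>i. polyfun_le d (g i)" and Z: "\<And>z i. z \<in> Z \<Longrightarrow> (z $ i) ^ Suc d = g i z"
  shows "card Z \<le> Suc d ^ CARD('n)"
proof (rule ccontr)
  assume *: "\<not> ?thesis"
  define B where "B = PiE (UNIV :: 'n set) (\<lambda>_. {..<Suc d})"
  have "finite B" "card B = Suc d ^ CARD('n)"
    unfolding B_def by (auto simp: card_PiE intro!: finite_PiE)
  \<comment> \<open>With more points in \<open>Z\<close> than monomials in the box \<open>B\<close>,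
    some nonzero functional on \<open>Z\<close> kills all of \<open>B\<close>.\<close>
  with homogeneous_system_nontrivial_solution[of B Z monom_fun] * fin
  obtain l w where l: "w \<in> Z" "l w \<noteq> 0" "\<And>b. b \<in> B \<Longrightarrow> (\<Sum>z\<in>Z. l z * monom_fun b z) = 0" by auto
  have mon: "(\<Sum>z\<in>Z. l z * monom_fun a z) = 0" for a
  proof (induction "\<Sum>i\<in>UNIV. a i" arbitrary: a rule: less_induct)
    case less
    show ?case
    proof (cases "a \<in> B")
      case True
      then show ?thesis by (rule l(3))
    next
      case False
      then obtain i where i: "a i \<ge> Suc d" by (auto simp: B_def PiE_def Pi_def not_less)
      define b where "b = a(i := a i - Suc d)"
      have a: "a = b(i := b i + Suc d)" using i by (auto simp: b_def fun_eq_iff)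
      have "(\<Sum>z\<in>Z. l z * monom_fun a z) = (\<Sum>z\<in>Z. l z * (monom_fun b z * g i z))"
        by (subst a, intro sum.cong) (simp_all only: monom_fun_upd Z)
      also have "\<dots> = 0"
      proof (rule polyfun_le_functional_eq_0[OF g])
        fix c :: "'n \<Rightarrow> nat" assume "(\<Sum>i\<in>UNIV. c i) \<le> (\<Sum>i\<in>UNIV. b i) + d"
        then show "(\<Sum>z\<in>Z. l z * monom_fun c z) = 0"
          using sum_fun_upd_add[of b i "Suc d"] a by (intro less) simp
      qed
      finally show ?thesis .
    qed
  qed
  \<comment> \<open>A product of squared distances to the points other than \<open>w\<close>. The
    functional kills all monomials, hence \<open>p\<close>, but its value on \<open>p\<close> is
    \<open>l w * p w\<close>, which is nonzero.\<close>
  define p where "p = (\<lambda>x :: real ^ 'n. \<Prod>z\<in>Z - {w}. \<Sum>i\<in>UNIV. (x $ i + - z $ i) ^ 2)"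
  have "polyfun_le (\<Sum>z\<in>Z - {w}. 2) p"
    unfolding p_def
    by (intro polyfun_le_prod polyfun_le_sum
        polyfun_le_mono[OF polyfun_le_power[OF polyfun_le.add[OF polyfun_le_nth polyfun_le.const]]]) auto
  from polyfun_le_functional_eq_0[OF this, of "\<lambda>_. 0" l Z] mon
  have "(\<Sum>z\<in>Z. l z * p z) = 0" by (simp add: monom_fun_def)
  moreover have "p z = 0" if "z \<in> Z - {w}" for z
    unfolding p_def using fin that by (intro prod_zero bexI[of _ z]) auto
  then have "(\<Sum>z\<in>Z. l z * p z) = (\<Sum>z\<in>{w}. l z * p z)"
    using fin l(1) by (intro sum.mono_neutral_right) auto
  moreover have "p w \<noteq> 0"
    using fin by (auto simp: p_def sum_nonneg_eq_0_iff vec_eq_iff prod_zero_iff)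
  ultimately show False using l(2) by simp
qed

section \<open>Sign patterns\<close>

lemma infnorm_power_le_sum:
  fixes x :: "real ^ 'n"
  shows "infnorm x ^ (2 * k) \<le> (\<Sum>i\<in>UNIV. (x $ i) ^ (2 * k))"
proof -
  have "infnorm x \<in> (\<lambda>b. \<bar>x \<bullet> b\<bar>) ` Basis"
    unfolding infnorm_Max by (rule Max_in) auto
  then obtain i where "infnorm x = \<bar>x $ i\<bar>"
    by (auto simp: Basis_vec_def inner_axis)
  then have "infnorm x ^ (2 * k) = (x $ i) ^ (2 * k)" by (simp add: power_mult)
  also have "\<dots> \<le> (\<Sum>i\<in>UNIV. (x $ i) ^ (2 * k))"
    by (rule member_le_sum) (auto simp: power_mult)
  finally show ?thesis .
qed

text \<open>\<open>z\<close> maximizes \<open>\<phi>\<close> on the closure of \<open>U\<close>. The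
  maximum is at least the positive value at \<open>q\<close>, and \<open>h\<close> is nonpositive on
  the boundary, so \<open>z\<close> lies inside \<open>U\<close> and all partial derivatives of
  \<open>\<phi>\<close> vanish there.\<close>

lemma exists_critical_point:
  fixes h :: "real ^ 'n \<Rightarrow> real"
  assumes h: "polyfun_le d h" and "\<eta> > 0" and U: "open U" "q \<in> U"
    and q: "h q > \<eta> * (\<Sum>i\<in>UNIV. (q $ i) ^ (2 * Suc d))"
    and bd: "\<And>x. x \<in> closure U \<Longrightarrow> x \<notin> U \<Longrightarrow> h x \<le> 0"
    and h': "\<And>i x. ((\<lambda>s. h (x + s *\<^sub>R axis i 1)) has_real_derivative h' i x) (at 0)"
  obtains z where "z \<in> U" "\<And>i. h' i z = \<eta> * (real (2 * Suc d) * (z $ i) ^ Suc (2 * d))"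
proof -
  define N where "N = (\<lambda>x :: real ^ 'n. \<Sum>i\<in>UNIV. (x $ i) ^ (2 * Suc d))"
  define \<phi> where "\<phi> = (\<lambda>x. h x - \<eta> * N x)"
  have cont: "continuous_on S \<phi>" for S
    unfolding \<phi>_def N_def by (intro continuous_intros continuous_on_polyfun_le[OF h])
  have N0: "N x \<ge> 0" for x unfolding N_def by (intro sum_nonneg) (simp only: power_mult zero_le_power zero_le_power2)
  have q0: "\<phi> q > 0" using q by (simp add: \<phi>_def N_def)
  obtain C where C: "C > 0" "\<And>x. \<bar>h x\<bar> \<le> C * max 1 (infnorm x) ^ d" using polyfun_le_growth[OF h] by blast
  \<comment> \<open>Where \<open>\<phi>\<close> is positive, \<open>h\<close> exceeds a term of
    order \<open>2 * d + 2\<close> but grows at most with order \<open>d\<close>. This confines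
    \<open>x\<close> and makes the superlevel set \<open>K\<close> compact.\<close>
  have bound: "infnorm x \<le> max 1 (C / \<eta>)" if "\<phi> x > 0" for x
  proof (rule ccontr)
    assume "\<not> ?thesis"
    then have x: "infnorm x > 1" "infnorm x > C / \<eta>" by auto
    have "\<eta> * infnorm x ^ (2 * Suc d) \<le> \<eta> * N x"
      unfolding N_def using \<open>\<eta> > 0\<close> by (intro mult_left_mono infnorm_power_le_sum) auto
    also have "\<dots> < h x" using that by (simp add: \<phi>_def)
    also have "\<dots> \<le> C * infnorm x ^ d" using C(2)[of x] x(1) by (simp add: max_def)
    finally have "\<eta> * infnorm x ^ (2 * Suc d) < C * infnorm x ^ d" .
    moreover have "infnorm x ^ (2 * Suc d) = infnorm x ^ (d + 2) * infnorm x ^ d"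
      by (simp add: power_add[symmetric] mult_2)
    ultimately have "\<eta> * infnorm x ^ (d + 2) < C" using x(1) by (simp add: mult.assoc[symmetric])
    moreover have "infnorm x \<le> infnorm x ^ (d + 2)" using x(1) by (intro self_le_power) auto
    then have "\<eta> * infnorm x \<le> \<eta> * infnorm x ^ (d + 2)" using \<open>\<eta> > 0\<close> by simp
    moreover have "C < \<eta> * infnorm x" using x(2) \<open>\<eta> > 0\<close> by (simp add: field_simps)
    ultimately show False by linarith
  qed
  define K where "K = closure U \<inter> {x. \<phi> q \<le> \<phi> x}"
  have "closed K" unfolding K_def
    by (intro closed_Int closed_closure closed_Collect_le continuous_on_const cont)
  moreover have "bounded K" unfolding bounded_iff
  proof (intro exI ballI)
    fix x assume "x \<in> K"
    then have "infnorm x \<le> max 1 (C / \<eta>)" using q0 by (intro bound) (auto simp: K_def)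
    then show "norm x \<le> sqrt DIM(real ^ 'n) * max 1 (C / \<eta>)"
      by (intro order_trans[OF norm_le_infnorm] mult_left_mono) auto
  qed
  moreover have "q \<in> K" using U(2) closure_subset by (auto simp: K_def)
  ultimately obtain z where z: "z \<in> K" "\<And>x. x \<in> K \<Longrightarrow> \<phi> x \<le> \<phi> z"
    using continuous_attains_sup[of K \<phi>] cont by (auto simp: compact_eq_bounded_closed)
  have "\<eta> * N z \<ge> 0" using N0[of z] \<open>\<eta> > 0\<close> by simp
  moreover have "\<phi> q \<le> \<phi> z" using z(1) by (simp add: K_def)
  ultimately have "h z > 0" using q0 unfolding \<phi>_def by linarith
  with z(1) bd have zU: "z \<in> U" by (force simp: K_def)
  have max: "\<phi> x \<le> \<phi> z" if "x \<in> U" for x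
    using z that closure_subset[of U] by (cases "\<phi> q \<le> \<phi> x") (auto simp: K_def)
  show thesis
  proof (rule that[OF zU])
    fix i
    obtain e where e: "e > 0" "ball z e \<subseteq> U" using U(1) zU by (auto simp: open_contains_ball)
    have "((\<lambda>s. N (z + s *\<^sub>R axis i 1)) has_real_derivative
        (\<Sum>j\<in>UNIV. real (2 * Suc d) * (z $ j) ^ Suc (2 * d) * (axis i 1 $ j))) (at 0)"
    proof -
      have "((\<lambda>s. ((z + s *\<^sub>R axis i 1) $ j) ^ n) has_real_derivative
          real n * (z $ j) ^ (n - 1) * (axis i 1 $ j)) (at 0)" for j n
        by (auto intro!: derivative_eq_intros)
      from this[where n = "2 * Suc d"] show ?thesis unfolding N_def by (intro DERIV_sum) simp
    qed
    moreover have "(\<Sum>j\<in>UNIV. real (2 * Suc d) * (z $ j) ^ Suc (2 * d) * (axis i 1 $ j)) =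
        real (2 * Suc d) * (z $ i) ^ Suc (2 * d)"
      by (simp add: axis_def if_distrib[of "\<lambda>x. _ * x"] cong: if_cong)
    ultimately have "((\<lambda>s. \<phi> (z + s *\<^sub>R axis i 1)) has_real_derivative
        h' i z - \<eta> * (real (2 * Suc d) * (z $ i) ^ Suc (2 * d))) (at 0)"
      unfolding \<phi>_def by (intro DERIV_diff h' DERIV_cmult) simp
    from DERIV_local_max[OF this e(1)]
    have "h' i z - \<eta> * (real (2 * Suc d) * (z $ i) ^ Suc (2 * d)) = 0"
      using e(2) by (force simp: dist_norm intro!: max)
    then show "h' i z = \<eta> * (real (2 * Suc d) * (z $ i) ^ Suc (2 * d))" by simp
  qed
qed

text \<open>Finitely many strict inequalities survive one small perturbation. All later choices of
  \<open>\<epsilon>\<close> and \<open>\<eta>\<close> that must preserve signs on a finite set come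
  from here.\<close>

lemma finite_uniform_gap:
  fixes a b :: "'a \<Rightarrow> real"
  assumes "finite A" "\<And>x. x \<in> A \<Longrightarrow> a x > 0"
  obtains \<eta> where "\<eta> > 0" "\<And>x. x \<in> A \<Longrightarrow> \<eta> * b x < a x"
proof -
  have "\<exists>\<eta>>0. \<forall>x\<in>A. \<eta> * b x < a x"
    using assms
  proof (induction A rule: finite_induct)
    case empty
    show ?case by (intro exI[of _ 1]) auto
  next
    case (insert x A)
    then obtain \<eta> where \<eta>: "\<eta> > 0" "\<forall>x\<in>A. \<eta> * b x < a x" by auto
    define \<theta> where "\<theta> = min \<eta> (a x / (1 + \<bar>b x\<bar>))"
    have "a x > 0" using insert by auto
    then have \<theta>: "\<theta> > 0" using \<eta>(1) by (auto simp: \<theta>_def)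
    have "\<theta> * b y < a y" if "y \<in> A" for y
    proof (cases "b y \<ge> 0")
      case True
      then have "\<theta> * b y \<le> \<eta> * b y" by (intro mult_right_mono) (auto simp: \<theta>_def)
      then show ?thesis using \<eta>(2) that by force
    next
      case False
      then have "\<theta> * b y \<le> 0" using \<theta> by (intro mult_nonneg_nonpos) auto
      moreover have "a y > 0" using insert that by auto
      ultimately show ?thesis by linarith
    qed
    moreover have "\<theta> * b x < a x"
    proof -
      have "\<theta> * b x < \<theta> * (1 + \<bar>b x\<bar>)" using \<theta> by (intro mult_strict_left_mono) auto
      also have "\<dots> \<le> a x / (1 + \<bar>b x\<bar>) * (1 + \<bar>b x\<bar>)" by (intro mult_right_mono) (auto simp: \<theta>_def)
      finally show ?thesis by simp
    qed
    ultimately show ?case using \<theta> by (intro exI[of _ \<theta>]) auto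
  qed
  then show thesis using that by blast
qed

text \<open>The region where all \<open>g j\<close> keep their signs at \<open>q\<close> contains a
  critical point, which thus carries the pattern of \<open>q\<close>. All these points solve one
  system, and \<open>card_common_zeros_le\<close> bounds their number. Only the zeros of
  \<open>h\<close> are prescribed, so both a product and its negative can be inserted.\<close>

lemma card_sign_patterns_positive_le:
  fixes g :: "'j \<Rightarrow> real ^ 'n \<Rightarrow> real"
  assumes "finite J" and g: "\<And>j. j \<in> J \<Longrightarrow> polyfun_le t (g j)"
    and h: "polyfun_le d h" and hg: "\<And>x. h x = 0 \<longleftrightarrow> (\<exists>j\<in>J. g j x = 0)"
    and "finite Q" and Q: "\<And>q. q \<in> Q \<Longrightarrow> h q > 0"
  shows "card ((\<lambda>q. {j\<in>J. g j q > 0}) ` Q) \<le> Suc (2 * d) ^ CARD('n)"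
proof -
  obtain \<eta> where \<eta>: "\<eta> > 0" "\<And>q. q \<in> Q \<Longrightarrow> \<eta> * (\<Sum>i\<in>UNIV. (q $ i) ^ (2 * Suc d)) < h q"
    by (rule finite_uniform_gap[OF \<open>finite Q\<close> Q, where b = "\<lambda>q. \<Sum>i\<in>UNIV. (q $ i) ^ (2 * Suc d)"]) blast+
  have "\<exists>h'. polyfun_le d h' \<and> (\<forall>x. ((\<lambda>s. h (x + s *\<^sub>R axis i 1)) has_real_derivative h' x) (at 0))" for i
  proof -
    obtain f' where "polyfun_le d f'"
      "\<And>x. ((\<lambda>s. h (x + s *\<^sub>R axis i 1)) has_real_derivative f' x) (at 0)"
      by (rule polyfun_le_partial_derivative[OF h, of i]) (rule that)
    then show ?thesis by (intro exI[of _ f']) simp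
  qed
  then have "\<exists>h'. \<forall>i. polyfun_le d (h' i) \<and> (\<forall>x. ((\<lambda>s. h (x + s *\<^sub>R axis i 1)) has_real_derivative h' i x) (at 0))"
    by (intro choice) simp
  then obtain h' where h': "\<And>i. polyfun_le d (h' i)"
    "\<And>i x. ((\<lambda>s. h (x + s *\<^sub>R axis i 1)) has_real_derivative h' i x) (at 0)"
    by blast
  have "\<exists>z. (\<forall>j\<in>J. g j q * g j z > 0) \<and> (\<forall>i. h' i z = \<eta> * (real (2 * Suc d) * (z $ i) ^ Suc (2 * d)))"
    if "q \<in> Q" for q
  proof -
    define U where "U = {z. \<forall>j\<in>J. g j q * g j z > 0}"
    have U_eq: "U = (\<Inter>j\<in>J. {z. g j q * g j z > 0})" by (auto simp: U_def)
    have "open U" unfolding U_eq using \<open>finite J\<close>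
      by (intro open_INT ballI open_Collect_less continuous_intros continuous_on_polyfun_le[OF g]) auto
    moreover have "q \<in> U" using Q[OF that] hg[of q] by (auto simp: U_def zero_less_mult_iff)
    \<comment> \<open>At a limit point of \<open>U\<close> outside \<open>U\<close> some
      \<open>g j\<close> vanishes, so \<open>h x = 0\<close>.\<close>
    moreover have "h x \<le> 0" if x: "x \<in> closure U" "x \<notin> U" for x
    proof -
      have "closed (\<Inter>j\<in>J. {z. g j q * g j z \<ge> 0})"
        by (intro closed_INT ballI closed_Collect_le continuous_intros continuous_on_polyfun_le[OF g]) auto
      moreover have "U \<subseteq> (\<Inter>j\<in>J. {z. g j q * g j z \<ge> 0})" by (auto simp: U_def less_imp_le)
      ultimately have "x \<in> (\<Inter>j\<in>J. {z. g j q * g j z \<ge> 0})" using x(1) closure_minimal by blast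
      then obtain j where "j \<in> J" "g j q * g j x = 0" using x(2) by (auto simp: U_def not_less order_antisym_conv)
      moreover from this have "g j q \<noteq> 0" using Q[OF \<open>q \<in> Q\<close>] hg[of q] by auto
      ultimately show ?thesis using hg[of x] by auto
    qed
    ultimately show ?thesis
      by (rule exists_critical_point[OF h \<eta>(1) _ _ \<eta>(2)[OF that] _ h'(2)]) (auto simp: U_def)
  qed
  then obtain w where w: "\<And>q j. q \<in> Q \<Longrightarrow> j \<in> J \<Longrightarrow> g j q * g j (w q) > 0"
    "\<And>q i. q \<in> Q \<Longrightarrow> h' i (w q) = \<eta> * (real (2 * Suc d) * (w q $ i) ^ Suc (2 * d))"
    by metis
  have "g j q > 0 \<longleftrightarrow> g j (w q) > 0" if "q \<in> Q" "j \<in> J" for q j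
    using w(1)[OF that] by (auto simp: zero_less_mult_iff)
  then have "(\<lambda>q. {j\<in>J. g j q > 0}) ` Q = (\<lambda>z. {j\<in>J. g j z > 0}) ` w ` Q"
    unfolding image_image by (intro image_cong Collect_cong) auto
  then have "card ((\<lambda>q. {j\<in>J. g j q > 0}) ` Q) \<le> card (w ` Q)"
    using \<open>finite Q\<close> by (simp add: card_image_le)
  also have "\<dots> \<le> Suc (2 * d) ^ CARD('n)"
  proof (rule card_common_zeros_le)
    show "finite (w ` Q)" using \<open>finite Q\<close> by simp
    \<comment> \<open>The critical equations are solved for their top power, of exponent
      \<open>Suc (2 * d)\<close>; the other side has degree at most \<open>d\<close>.\<close>
    show "polyfun_le (2 * d) (\<lambda>x. (1 / (\<eta> * real (2 * Suc d))) * h' i x)" for i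
      using polyfun_le_mono[OF h'(1), of "2 * d" i] by (intro polyfun_le_cmult) simp
    show "(z $ i) ^ Suc (2 * d) = (1 / (\<eta> * real (2 * Suc d))) * h' i z" if "z \<in> w ` Q" for z i
      using that w(2)[of _ i] \<eta>(1) by (auto simp del: of_nat_mult power_Suc)
  qed
  finally show ?thesis .
qed

text \<open>Warren's bound. Between the zero sets, every sign region of \<open>\<Prod>j. g j\<close> contains a critical
  point of that product after subtracting a small multiple of \<open>\<Sum>i. (x $ i) ^ (2 * Suc d)\<close>; this
  term makes the function coercive and gives the critical equations the shape required by
  \<^term>\<open>card_common_zeros_le\<close>.\<close>

lemma card_sign_patterns_le:
  fixes f :: "'j \<Rightarrow> real ^ 'n \<Rightarrow> real"
  assumes "finite J" and f: "\<And>j. j \<in> J \<Longrightarrow> polyfun_le t (f j)" and "finite Q"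
  shows "card ((\<lambda>q. {j\<in>J. f j q \<ge> 0}) ` Q) \<le> 2 * Suc (2 * (card J * t)) ^ CARD('n)"
proof -
  \<comment> \<open>Raising all functions by an \<open>\<epsilon>\<close> smaller than every
    absolute value of a negative value turns \<open>\<ge> 0\<close> into \<open>> 0\<close> on
    \<open>Q\<close> and leaves no zeros there.\<close>
  define A where "A = {x \<in> J \<times> Q. f (fst x) (snd x) < 0}"
  have "finite A" "\<And>x. x \<in> A \<Longrightarrow> - f (fst x) (snd x) > 0" using assms by (auto simp: A_def)
  then obtain \<epsilon> where \<epsilon>: "\<epsilon> > 0" "\<And>x. x \<in> A \<Longrightarrow> \<epsilon> * 1 < - f (fst x) (snd x)"
    by (rule finite_uniform_gap[of A "\<lambda>x. - f (fst x) (snd x)" "\<lambda>_. 1"]) blast+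
  define g where "g = (\<lambda>j x. f j x + \<epsilon>)"
  define h where "h = (\<lambda>x. \<Prod>j\<in>J. g j x)"
  have g: "polyfun_le t (g j)" if "j \<in> J" for j unfolding g_def using f[OF that] by (intro polyfun_le.add polyfun_le.const)
  have h: "polyfun_le (card J * t) h" unfolding h_def using polyfun_le_prod[OF g] by simp
  have h0: "h x = 0 \<longleftrightarrow> (\<exists>j\<in>J. g j x = 0)" for x
    unfolding h_def using \<open>finite J\<close> by (auto simp: prod_zero_iff)
  have sgn: "f j q \<ge> 0 \<longleftrightarrow> g j q > 0" "g j q \<noteq> 0" if "j \<in> J" "q \<in> Q" for j q
    using \<epsilon>(1) \<epsilon>(2)[of "(j, q)"] that by (cases "f j q < 0"; force simp: A_def g_def)+
  define P where "P = (\<lambda>q. {j\<in>J. g j q > 0})"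
  have "(\<lambda>q. {j\<in>J. f j q \<ge> 0}) ` Q = P ` Q"
    unfolding P_def by (intro image_cong) (auto simp: sgn)
  \<comment> \<open>The points with negative product are handled through \<open>- h\<close>; this is
    the factor 2 in the bound.\<close>
  also have "\<dots> \<subseteq> P ` {q\<in>Q. h q > 0} \<union> P ` {q\<in>Q. - h q > 0}"
  proof -
    have "h q \<noteq> 0" if "q \<in> Q" for q using h0 sgn(2) that by blast
    then have "h q > 0 \<or> - h q > 0" if "q \<in> Q" for q using that by (simp add: neq_iff disj_commute)
    then show ?thesis by blast
  qed
  finally have "card ((\<lambda>q. {j\<in>J. f j q \<ge> 0}) ` Q) \<le>
      card (P ` {q\<in>Q. h q > 0} \<union> P ` {q\<in>Q. - h q > 0})"
    using \<open>finite Q\<close> by (intro card_mono) auto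
  also have "\<dots> \<le> card (P ` {q\<in>Q. h q > 0}) + card (P ` {q\<in>Q. - h q > 0})" by (rule card_Un_le)
  also have "card (P ` {q\<in>Q. h q > 0}) \<le> Suc (2 * (card J * t)) ^ CARD('n)"
    unfolding P_def using assms(1,3) by (intro card_sign_patterns_positive_le[OF _ g h h0]) auto
  also have "card (P ` {q\<in>Q. - h q > 0}) \<le> Suc (2 * (card J * t)) ^ CARD('n)"
    unfolding P_def using assms(1,3) h0
    by (intro card_sign_patterns_positive_le[OF _ g polyfun_le_uminus[OF h]]) auto
  finally show ?thesis by simp
qed

section \<open>Unit distance edges of a set family\<close>

definition shatters :: "'a set set \<Rightarrow> 'a set \<Rightarrow> bool" where
  "shatters F T \<longleftrightarrow> (\<forall>U\<subseteq>T. \<exists>B\<in>F. B \<inter> T = U)"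

lemma shatters_mono: "shatters F T \<Longrightarrow> F \<subseteq> G \<Longrightarrow> shatters G T"
  unfolding shatters_def by (meson subsetD)

text \<open>The edges, with direction in \<open>S\<close>, of the hypercube graph induced on
  \<open>F\<close>. Recording the direction \<open>x\<close> and the lower end \<open>B\<close>
  counts each edge once.\<close>

definition cube_edges :: "'a set \<Rightarrow> 'a set set \<Rightarrow> ('a \<times> 'a set) set" where
  "cube_edges S F = {(x, B). x \<in> S \<and> x \<notin> B \<and> B \<in> F \<and> insert x B \<in> F}"

lemma finite_cube_edges: "finite S \<Longrightarrow> finite F \<Longrightarrow> finite (cube_edges S F)"
  by (rule finite_subset[of _ "S \<times> F"]) (auto simp: cube_edges_def)

text \<open>Haussler's bound of the edge density by the VC dimension. Deleting \<open>x\<close>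
  yields the traces \<open>F1\<close> and the family \<open>F2\<close> of sets present both with and
  without \<open>x\<close>. There are \<open>card F2\<close> edges in direction \<open>x\<close>,
  and the others are charged to edges of \<open>F1\<close> and \<open>F2\<close>. If
  \<open>F2\<close> shatters \<open>T\<close>, then \<open>F\<close> shatters
  \<open>insert x T\<close>, so \<open>k\<close> drops by one for \<open>F2\<close>.\<close>

lemma card_cube_edges_le:
  assumes "finite S" "F \<subseteq> Pow S" "\<And>T. T \<subseteq> S \<Longrightarrow> shatters F T \<Longrightarrow> card T \<le> k"
  shows "card (cube_edges S F) \<le> k * card F"
  using assms
proof (induction S arbitrary: F k rule: finite_induct)
  case empty
  then show ?case by (simp add: cube_edges_def)
next
  case (insert x S)
  define F1 where "F1 = (\<lambda>B. B - {x}) ` F"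
  define F2 where "F2 = {B \<in> F. x \<notin> B \<and> insert x B \<in> F}"
  have finF: "finite F" using insert by (meson finite.insertI finite_Pow_iff finite_subset)
  then have fin: "finite F1" "finite F2" by (auto simp: F1_def F2_def)
  have sub: "F1 \<subseteq> Pow S" "F2 \<subseteq> Pow S" using insert.prems(1) by (auto simp: F1_def F2_def)
  have F1_iff: "B \<in> F1 \<longleftrightarrow> x \<notin> B \<and> (B \<in> F \<or> insert x B \<in> F)" for B
  proof
    assume "B \<in> F1"
    then obtain A where "A \<in> F" "B = A - {x}" by (auto simp: F1_def)
    then show "x \<notin> B \<and> (B \<in> F \<or> insert x B \<in> F)" by (cases "x \<in> A") (auto simp: insert_absorb)
  next
    assume "x \<notin> B \<and> (B \<in> F \<or> insert x B \<in> F)"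
    then have "B = B - {x}" "B = insert x B - {x}" "B \<in> F \<or> insert x B \<in> F" by auto
    then show "B \<in> F1" unfolding F1_def by blast
  qed
  define G where "G = {B \<in> F. x \<notin> B}"
  define H where "H = {B. x \<notin> B \<and> insert x B \<in> F}"
  have "H = (\<lambda>B. B - {x}) ` {B \<in> F. x \<in> B}"
  proof (intro equalityI subsetI)
    fix B assume "B \<in> H"
    then have "insert x B \<in> {B \<in> F. x \<in> B}" "B = insert x B - {x}" by (auto simp: H_def)
    then show "B \<in> (\<lambda>B. B - {x}) ` {B \<in> F. x \<in> B}" by blast
  qed (auto simp: H_def insert_absorb)
  moreover have "inj_on (\<lambda>B. B - {x}) {B \<in> F. x \<in> B}"
    by (rule inj_onI) (metis (no_types, lifting) insert_Diff mem_Collect_eq)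
  ultimately have cardH: "card H = card {B \<in> F. x \<in> B}" "finite H" using finF by (auto simp: card_image)
  have "F1 = G \<union> H" "F2 = G \<inter> H" by (auto simp: F1_iff G_def H_def F2_def)
  then have "card F1 + card F2 = card G + card {B \<in> F. x \<in> B}"
    using cardH finF card_Un_Int[of G H] by (simp add: G_def)
  also have "\<dots> = card (G \<union> {B \<in> F. x \<in> B})"
    using finF by (intro card_Un_disjoint[symmetric]) (auto simp: G_def)
  also have "G \<union> {B \<in> F. x \<in> B} = F" by (auto simp: G_def)
  finally have cardF: "card F = card F1 + card F2" ..
  have edges: "card (cube_edges (insert x S) F) \<le> card F2 + (card (cube_edges S F1) + card (cube_edges S F2))"
  proof -
    \<comment> \<open>\<open>E0\<close> is the layer of edges without \<open>x\<close>,
      \<open>E1'\<close> the layer with \<open>x\<close>, and \<open>E1\<close> the latter moved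
      down by deleting \<open>x\<close>. An edge in either layer belongs to \<open>F1\<close>, an
      edge in both to \<open>F2\<close>.\<close>
    define E0 where "E0 = {(y, B) \<in> cube_edges S F. x \<notin> B}"
    define E1 where "E1 = {(y, B). (y, insert x B) \<in> cube_edges S F \<and> x \<notin> B}"
    define E1' where "E1' = {(y, B) \<in> cube_edges S F. x \<in> B}"
    have finE: "finite (cube_edges S F)" using insert finF by (intro finite_cube_edges) auto
    have E01: "E0 \<union> E1 \<subseteq> cube_edges S F1" "E0 \<inter> E1 \<subseteq> cube_edges S F2"
      using insert.hyps by (auto simp: E0_def E1_def cube_edges_def F1_iff F2_def insert_commute)
    have finE1: "finite (cube_edges S F1)" "finite (cube_edges S F2)"
      using insert fin by (auto intro: finite_cube_edges)
    have "E1' = map_prod id (insert x) ` E1"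
    proof
      show "E1' \<subseteq> map_prod id (insert x) ` E1"
      proof
        fix e assume e: "e \<in> E1'"
        obtain y B where yB: "e = (y, B)" by (cases e)
        have "insert x (B - {x}) = B" using e by (auto simp: E1'_def yB)
        then have "(y, B - {x}) \<in> E1" "e = map_prod id (insert x) (y, B - {x})"
          using e by (simp_all add: E1'_def E1_def yB)
        then show "e \<in> map_prod id (insert x) ` E1" by blast
      qed
    qed (auto simp: E1'_def E1_def)
    moreover have "inj_on (map_prod id (insert x)) E1"
      by (auto simp: E1_def inj_on_def)
    ultimately have cE1: "card E1' = card E1" by (simp add: card_image)
    have "cube_edges (insert x S) F = Pair x ` F2 \<union> (E0 \<union> E1')"
      using insert.hyps by (auto simp: cube_edges_def F2_def E0_def E1'_def)
    then have "card (cube_edges (insert x S) F) \<le> card (Pair x ` F2) + (card E0 + card E1')"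
      using card_Un_le[of "Pair x ` F2" "E0 \<union> E1'"] card_Un_le[of E0 E1'] by simp
    also have "card (Pair x ` F2) \<le> card F2" using fin by (intro card_image_le)
    also have "card E0 + card E1' = card (E0 \<union> E1) + card (E0 \<inter> E1)"
      unfolding cE1 using E01 finE finE1 
      by (intro card_Un_Int) (auto simp: E0_def intro: finite_subset[OF _ finE] finite_subset[OF _ finE1(1)])
    also have "\<dots> \<le> card (cube_edges S F1) + card (cube_edges S F2)"
      using E01 finE1 by (intro add_mono card_mono)
    finally show ?thesis by simp
  qed
  have "card (cube_edges S F1) \<le> k * card F1"
  proof (rule insert.IH[OF sub(1)])
    fix T assume T: "T \<subseteq> S" "shatters F1 T"
    have "shatters F T" unfolding shatters_def
    proof (intro allI impI)
      fix U assume "U \<subseteq> T"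
      then obtain B where "B \<in> F1" "B \<inter> T = U" using T(2) by (auto simp: shatters_def)
      moreover from this have "insert x B \<inter> T = U" using T(1) insert.hyps by auto
      ultimately show "\<exists>B\<in>F. B \<inter> T = U" unfolding F1_iff by blast
    qed
    then show "card T \<le> k" using T(1) insert.prems(2) by blast
  qed
  moreover have "card (cube_edges S F2) + card F2 \<le> k * card F2"
  proof (cases "F2 = {}")
    case True
    then show ?thesis by (simp add: cube_edges_def)
  next
    case False
    have *: "Suc (card T) \<le> k" if T: "T \<subseteq> S" "shatters F2 T" for T
    proof -
      have "shatters F (insert x T)" unfolding shatters_def
      proof (intro allI impI)
        fix U assume U: "U \<subseteq> insert x T"
        then have "U - {x} \<subseteq> T" by auto
        then obtain B where B: "B \<in> F2" "B \<inter> T = U - {x}"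
          using T(2) unfolding shatters_def by blast
        show "\<exists>B\<in>F. B \<inter> insert x T = U"
        proof (cases "x \<in> U")
          case True
          then have "insert x B \<inter> insert x T = U" using B(2) by auto
          then show ?thesis using B(1) unfolding F2_def by blast
        next
          case False
          then have "B \<inter> insert x T = U" using B by (auto simp: F2_def)
          then show ?thesis using B(1) unfolding F2_def by blast
        qed
      qed
      then have "card (insert x T) \<le> k" using T(1) by (intro insert.prems(2)) auto
      moreover have "x \<notin> T" "finite T" using T(1) insert.hyps finite_subset by auto
      ultimately show ?thesis by simp
    qed
    \<comment> \<open>A nonempty family shatters the empty set, so \<open>k\<close> is positive and
      can be lowered by one.\<close>
    have "shatters F2 {}" using False by (auto simp: shatters_def)
    then obtain k' where k: "k = Suc k'" using *[of "{}"] by (auto simp: Suc_le_eq gr0_conv_Suc)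
    have "card (cube_edges S F2) \<le> k' * card F2"
      using * by (intro insert.IH[OF sub(2)]) (simp add: k)
    then show ?thesis by (simp add: k)
  qed
  ultimately show ?case using edges unfolding cardF by (simp add: distrib_left)
qed

section \<open>Double counting and weighted cube edges\<close>

lemma nat_eq_sum_indicator:
  fixes n m :: nat
  assumes "n \<le> m"
  shows "n = (\<Sum>j=1..m. if j \<le> n then 1 else 0)"
proof -
  have "(\<Sum>j=1..m. if j \<le> n then 1 else 0) = card {j\<in>{1..m}. j \<le> n}" by (simp add: sum.If_cases Int_def)
  also have "{j\<in>{1..m}. j \<le> n} = {1..n}" using assms by auto
  finally show ?thesis by simp
qed

lemma sum_card_swap:
  assumes "finite A" "finite B"
  shows "(\<Sum>a\<in>A. card {b\<in>B. R a b}) = (\<Sum>b\<in>B. card {a\<in>A. R a b})"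
proof -
  have "(\<Sum>a\<in>A. card {b\<in>B. R a b}) = (\<Sum>a\<in>A. \<Sum>b\<in>B. if R a b then 1 else 0)"
    using assms by (simp add: sum.If_cases Int_def)
  also have "\<dots> = (\<Sum>b\<in>B. \<Sum>a\<in>A. if R a b then 1 else 0)" by (rule sum.swap)
  also have "\<dots> = (\<Sum>b\<in>B. card {a\<in>A. R a b})"
    using assms by (simp add: sum.If_cases Int_def)
  finally show ?thesis .
qed

text \<open>The weighted version follows by applying the unweighted one to every superlevel set of \<open>w\<close>.\<close>

lemma sum_min_cube_edges_le:
  fixes w :: "'a set \<Rightarrow> nat"
  assumes "finite S" "\<And>T. T \<subseteq> S \<Longrightarrow> shatters {B \<in> Pow S. w B > 0} T \<Longrightarrow> card T \<le> k"
  shows "(\<Sum>x\<in>S. \<Sum>B\<in>Pow (S - {x}). min (w B) (w (insert x B))) \<le> k * (\<Sum>B\<in>Pow S. w B)"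
proof -
  define m where "m = (\<Sum>B\<in>Pow S. w B)"
  define F where "F j = {B \<in> Pow S. j \<le> w B}" for j
  have le_m: "w B \<le> m" if "B \<subseteq> S" for B
    unfolding m_def using that assms(1) by (intro member_le_sum) auto
  have "(\<Sum>x\<in>S. \<Sum>B\<in>Pow (S - {x}). min (w B) (w (insert x B))) =
      (\<Sum>x\<in>S. \<Sum>B\<in>Pow (S - {x}). \<Sum>j=1..m. if j \<le> min (w B) (w (insert x B)) then 1 else 0)"
  proof (intro sum.cong refl nat_eq_sum_indicator)
    fix x B assume "x \<in> S" "B \<in> Pow (S - {x})"
    then show "min (w B) (w (insert x B)) \<le> m" using le_m[of B] by (auto simp: min_le_iff_disj)
  qed
  also have "\<dots> = (\<Sum>x\<in>S. \<Sum>j=1..m. \<Sum>B\<in>Pow (S - {x}). if j \<le> min (w B) (w (insert x B)) then 1 else 0)"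
    by (intro sum.cong refl sum.swap)
  also have "\<dots> = (\<Sum>j=1..m. \<Sum>x\<in>S. \<Sum>B\<in>Pow (S - {x}). if j \<le> min (w B) (w (insert x B)) then 1 else 0)"
    by (rule sum.swap)
  also have "\<dots> = (\<Sum>j=1..m. card (cube_edges S (F j)))"
  proof (rule sum.cong[OF refl])
    fix j
    have "(\<Sum>x\<in>S. \<Sum>B\<in>Pow (S - {x}). if j \<le> min (w B) (w (insert x B)) then 1 else 0)
        = (\<Sum>x\<in>S. card {B\<in>Pow (S - {x}). j \<le> min (w B) (w (insert x B))})"
      using assms(1) by (simp add: sum.If_cases Int_def)
    also have "\<dots> = card (SIGMA x:S. {B\<in>Pow (S - {x}). j \<le> min (w B) (w (insert x B))})"
      using assms(1) by (intro card_SigmaI[symmetric]) auto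
    also have "(SIGMA x:S. {B\<in>Pow (S - {x}). j \<le> min (w B) (w (insert x B))}) = cube_edges S (F j)"
      by (auto simp: cube_edges_def F_def)
    finally show "(\<Sum>x\<in>S. \<Sum>B\<in>Pow (S - {x}). if j \<le> min (w B) (w (insert x B)) then 1 else 0)
      = card (cube_edges S (F j))" .
  qed
  also have "\<dots> \<le> (\<Sum>j=1..m. k * card (F j))"
  proof (rule sum_mono)
    fix j assume j: "j \<in> {1..m}"
    show "card (cube_edges S (F j)) \<le> k * card (F j)"
    proof (rule card_cube_edges_le[OF assms(1)])
      fix T assume T: "T \<subseteq> S" "shatters (F j) T"
      \<comment> \<open>Levels start at 1 because only then is a superlevel set contained in the
        support of \<open>w\<close>, whose shattered sets are bounded.\<close>
      have "F j \<subseteq> {B \<in> Pow S. w B > 0}" using j by (auto simp: F_def)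
      then show "card T \<le> k" using T by (intro assms(2)) (auto intro: shatters_mono)
    qed (auto simp: F_def)
  qed
  also have "\<dots> = k * (\<Sum>j=1..m. \<Sum>B\<in>Pow S. if j \<le> w B then 1 else 0)"
    using assms(1) by (simp add: sum_distrib_left sum.If_cases Int_def F_def)
  also have "(\<Sum>j=1..m. \<Sum>B\<in>Pow S. if j \<le> w B then 1 else 0) = (\<Sum>B\<in>Pow S. w B)"
    using le_m by (subst sum.swap) (intro sum.cong refl nat_eq_sum_indicator[symmetric], auto)
  finally show ?thesis .
qed

section \<open>Separated set systems\<close>

text \<open>Drawing \<open>Suc r\<close> points and singling one out amounts to drawing
  \<open>r\<close> points and then one more.\<close>

lemma sum_subsets_remove:
  fixes g :: "'a set \<Rightarrow> 'a \<Rightarrow> 'b::comm_monoid_add"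
  assumes "finite P"
  shows "(\<Sum>S | S \<subseteq> P \<and> card S = Suc r. \<Sum>x\<in>S. g (S - {x}) x) =
    (\<Sum>S | S \<subseteq> P \<and> card S = r. \<Sum>x\<in>P - S. g S x)"
proof -
  have fin: "finite {S. S \<subseteq> P \<and> card S = n}" for n using assms by simp
  have finS: "finite S" if "S \<subseteq> P" for S using assms that finite_subset by blast
  have "(\<Sum>S | S \<subseteq> P \<and> card S = Suc r. \<Sum>x\<in>S. g (S - {x}) x) =
      (\<Sum>(S, x)\<in>(SIGMA S:{S. S \<subseteq> P \<and> card S = Suc r}. S). g (S - {x}) x)"
    by (rule sum.Sigma[OF fin]) (auto intro: finS)
  also have "\<dots> = (\<Sum>(S, x)\<in>(SIGMA S:{S. S \<subseteq> P \<and> card S = r}. P - S). g S x)"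
    by (rule sum.reindex_bij_witness[where i = "\<lambda>(S, x). (insert x S, x)" and j = "\<lambda>(S, x). (S - {x}, x)"])
      (auto simp: insert_absorb finS)
  also have "\<dots> = (\<Sum>S | S \<subseteq> P \<and> card S = r. \<Sum>x\<in>P - S. g S x)"
    by (rule sum.Sigma[OF fin, symmetric]) (use assms in auto)
  finally show ?thesis .
qed

lemma card_subsets_Suc:
  assumes "finite P"
  shows "Suc r * card {S. S \<subseteq> P \<and> card S = Suc r} = (card P - r) * card {S. S \<subseteq> P \<and> card S = r}"
proof -
  have "(\<Sum>S | S \<subseteq> P \<and> card S = Suc r. \<Sum>x\<in>S. 1) = (\<Sum>S | S \<subseteq> P \<and> card S = r. \<Sum>x\<in>P - S. (1::nat))"
    by (rule sum_subsets_remove[OF assms])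
  moreover have "(\<Sum>S | S \<subseteq> P \<and> card S = r. \<Sum>x\<in>P - S. (1::nat)) = (\<Sum>S | S \<subseteq> P \<and> card S = r. card P - r)"
    using assms by (intro sum.cong) (auto simp: card_Diff_subset finite_subset)
  ultimately show ?thesis by (simp add: mult.commute)
qed

text \<open>Sum \<open>card (N q - N q')\<close> over ordered pairs of \<open>n\<close> members. A
  point \<open>x\<close> contributes the number of sets containing it times the number avoiding it,
  at most \<open>n\<close> times the smaller. Separation gives the lower bound with factor
  \<open>n - 1\<close>, and \<open>n - 1 \<ge> n / 2\<close> leaves \<open>c / 2\<close>.\<close>

lemma separated_class_le:
  fixes N :: "'b \<Rightarrow> 'a set"
  assumes "finite A" "2 \<le> card A" "finite X" "c \<ge> 0"
    and X: "\<And>q q'. q \<in> A \<Longrightarrow> q' \<in> A \<Longrightarrow> N q - N q' \<subseteq> X"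
    and sep: "\<And>q q'. q \<in> A \<Longrightarrow> q' \<in> A \<Longrightarrow> q \<noteq> q' \<Longrightarrow> c * real (card (N q)) \<le> real (card (N q - N q'))"
  shows "c / 2 * (\<Sum>q\<in>A. real (card (N q))) \<le>
    (\<Sum>x\<in>X. real (min (card {q\<in>A. x \<notin> N q}) (card {q\<in>A. x \<in> N q})))"
proof -
  define n where "n = card A"
  have "real n * (c / 2 * (\<Sum>q\<in>A. real (card (N q)))) \<le> (real n - 1) * (c * (\<Sum>q\<in>A. real (card (N q))))"
  proof -
    have "real n / 2 * (c * (\<Sum>q\<in>A. real (card (N q)))) \<le> (real n - 1) * (c * (\<Sum>q\<in>A. real (card (N q))))"
      using assms by (intro mult_right_mono mult_nonneg_nonneg sum_nonneg) (auto simp: n_def)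
    then show ?thesis by simp
  qed
  also have "\<dots> = (\<Sum>q\<in>A. (real n - 1) * (c * real (card (N q))))" by (simp add: sum_distrib_left)
  also have "\<dots> = (\<Sum>q\<in>A. \<Sum>q'\<in>A - {q}. c * real (card (N q)))"
    using assms(1,2) by (intro sum.cong) (auto simp: n_def card_Diff_singleton of_nat_diff)
  also have "\<dots> \<le> (\<Sum>q\<in>A. \<Sum>q'\<in>A - {q}. real (card (N q - N q')))"
    using sep by (intro sum_mono) auto
  also have "\<dots> \<le> (\<Sum>q\<in>A. \<Sum>q'\<in>A. real (card (N q - N q')))"
    using assms(1) by (intro sum_mono sum_mono2) auto
  also have "\<dots> = real (\<Sum>e\<in>A \<times> A. card {x\<in>X. x \<in> N (fst e) - N (snd e)})"
    unfolding of_nat_sum sum.cartesian_product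
  proof (intro sum.cong refl)
    fix e assume "e \<in> A \<times> A"
    then have "N (fst e) - N (snd e) = {x\<in>X. x \<in> N (fst e) - N (snd e)}"
      using X[of "fst e" "snd e"] by auto
    then show "(case e of (q, q') \<Rightarrow> real (card (N q - N q'))) = real (card {x\<in>X. x \<in> N (fst e) - N (snd e)})"
      by (simp add: case_prod_beta)
  qed
  also have "(\<Sum>e\<in>A \<times> A. card {x\<in>X. x \<in> N (fst e) - N (snd e)}) =
      (\<Sum>x\<in>X. card {e\<in>A \<times> A. x \<in> N (fst e) - N (snd e)})"
    using assms(1,3) by (intro sum_card_swap) auto
  also have "\<dots> = (\<Sum>x\<in>X. card {q\<in>A. x \<notin> N q} * card {q\<in>A. x \<in> N q})"
  proof (rule sum.cong[OF refl])
    fix x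
    have "{e\<in>A \<times> A. x \<in> N (fst e) - N (snd e)} = {q\<in>A. x \<in> N q} \<times> {q\<in>A. x \<notin> N q}" by auto
    then show "card {e\<in>A \<times> A. x \<in> N (fst e) - N (snd e)} = card {q\<in>A. x \<notin> N q} * card {q\<in>A. x \<in> N q}"
      by (simp add: card_cartesian_product)
  qed
  also have "\<dots> \<le> (\<Sum>x\<in>X. n * min (card {q\<in>A. x \<notin> N q}) (card {q\<in>A. x \<in> N q}))"
  proof (rule sum_mono)
    fix x
    have "card {q\<in>A. x \<notin> N q} \<le> n" "card {q\<in>A. x \<in> N q} \<le> n"
      unfolding n_def using assms(1) by (auto intro: card_mono)
    then show "card {q\<in>A. x \<notin> N q} * card {q\<in>A. x \<in> N q} \<le>
        n * min (card {q\<in>A. x \<notin> N q}) (card {q\<in>A. x \<in> N q})"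
      by (auto simp: min_def mult.commute)
  qed
  finally have "real n * (c / 2 * (\<Sum>q\<in>A. real (card (N q)))) \<le>
      real n * (\<Sum>x\<in>X. real (min (card {q\<in>A. x \<notin> N q}) (card {q\<in>A. x \<in> N q})))"
    by (simp add: sum_distrib_left)
  then show ?thesis using assms(2) by (auto simp: n_def)
qed

text \<open>Chazelle's sampling argument. Average, over the subsets \<open>S\<close> with \<open>Suc r\<close> elements, the weight of
  the cube edges of the traces on \<open>S\<close>: by \<^term>\<open>sum_min_cube_edges_le\<close> it is at most
  \<open>k * card Q\<close>, whereas separation forces the two halves into which a random \<open>x\<close> splits a class of
  \<open>S - {x}\<close> to be large, unless that class is a singleton.\<close>

lemma sampling:
  fixes N :: "'b \<Rightarrow> 'a set"
  assumes finP: "finite P" and finQ: "finite Q" and N: "\<And>q. q \<in> Q \<Longrightarrow> N q \<subseteq> P" and "c \<ge> 0"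
    and sep: "\<And>q q'. q \<in> Q \<Longrightarrow> q' \<in> Q \<Longrightarrow> q \<noteq> q' \<Longrightarrow> c * real (card (N q)) \<le> real (card (N q - N q'))"
    and VC: "\<And>T. T \<subseteq> P \<Longrightarrow> shatters (N ` Q) T \<Longrightarrow> card T \<le> k"
    and r: "r \<le> card P"
  obtains S where "S \<subseteq> P" "card S = r"
    "c / 2 * (\<Sum>q\<in>Q - {q\<in>Q. \<forall>q'\<in>Q. N q' \<inter> S = N q \<inter> S \<longrightarrow> q' = q}. real (card (N q))) * real (Suc r)
      \<le> real k * real (card Q) * real (card P)"
proof -
  \<comment> \<open>\<open>sing S\<close> holds the points alone in their trace class on
    \<open>S\<close>, \<open>w\<close> the class sizes, and \<open>W S x\<close> the sum over these
    classes of the smaller part when \<open>x\<close> splits them.\<close>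
  define sing where "sing = (\<lambda>S. {q\<in>Q. \<forall>q'\<in>Q. N q' \<inter> S = N q \<inter> S \<longrightarrow> q' = q})"
  define w where "w = (\<lambda>S B. card {q\<in>Q. N q \<inter> S = B})"
  define W where "W = (\<lambda>S x. \<Sum>B\<in>Pow S. min (w (insert x S) B) (w (insert x S) (insert x B)))"
  define Ps where "Ps = (\<lambda>n. {S. S \<subseteq> P \<and> card S = n})"
  have finS: "finite S" if "S \<subseteq> P" for S using that finP finite_subset by blast
  have finPs: "finite (Ps n)" for n unfolding Ps_def using finP by simp
  have upper: "(\<Sum>x\<in>S. W (S - {x}) x) \<le> k * card Q" if S: "S \<subseteq> P" for S
  proof -
    have "(\<Sum>x\<in>S. W (S - {x}) x) = (\<Sum>x\<in>S. \<Sum>B\<in>Pow (S - {x}). min (w S B) (w S (insert x B)))"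
      by (intro sum.cong refl) (auto simp: W_def insert_absorb)
    also have "\<dots> \<le> k * (\<Sum>B\<in>Pow S. w S B)"
    proof (rule sum_min_cube_edges_le[OF finS[OF S]])
      fix T assume T: "T \<subseteq> S" "shatters {B \<in> Pow S. w S B > 0} T"
      have "shatters (N ` Q) T" unfolding shatters_def
      proof (intro allI impI)
        fix U assume "U \<subseteq> T"
        then obtain B where B: "w S B > 0" "B \<inter> T = U" using T(2) by (auto simp: shatters_def)
        then obtain q where "q \<in> Q" "N q \<inter> S = B" by (fastforce simp: w_def card_gt_0_iff)
        then have "N q \<inter> T = U" "q \<in> Q" using B(2) T(1) by auto
        then show "\<exists>B\<in>N ` Q. B \<inter> T = U" by blast
      qed
      then show "card T \<le> k" using T(1) S by (intro VC) auto
    qed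
    also have "(\<Sum>B\<in>Pow S. w S B) = (\<Sum>B\<in>Pow S. \<Sum>q\<in>{q\<in>Q. N q \<inter> S = B}. 1)"
      by (simp add: w_def)
    also have "\<dots> = (\<Sum>q\<in>Q. 1)" using finQ finS[OF S] by (intro sum.group) auto
    finally show ?thesis by simp
  qed
  have lower: "c / 2 * (\<Sum>q\<in>Q - sing S. real (card (N q))) \<le> real (\<Sum>x\<in>P - S. W S x)" if S: "S \<subseteq> P" for S
  proof -
    define A where "A = (\<lambda>B. {q\<in>Q. N q \<inter> S = B})"
    have "c / 2 * (\<Sum>q\<in>Q - sing S. real (card (N q))) =
        c / 2 * (\<Sum>B\<in>Pow S. \<Sum>q\<in>{q\<in>Q - sing S. N q \<inter> S = B}. real (card (N q)))"
      using finQ finS[OF S] by (subst sum.group) auto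
    also have "\<dots> = (\<Sum>B\<in>Pow S. c / 2 * (\<Sum>q\<in>{q\<in>Q - sing S. N q \<inter> S = B}. real (card (N q))))"
      by (simp add: sum_distrib_left)
    also have "\<dots> \<le> (\<Sum>B\<in>Pow S. \<Sum>x\<in>P - S. real (min (card {q\<in>A B. x \<notin> N q}) (card {q\<in>A B. x \<in> N q})))"
    proof (rule sum_mono)
      fix B assume "B \<in> Pow S"
      show "c / 2 * (\<Sum>q\<in>{q\<in>Q - sing S. N q \<inter> S = B}. real (card (N q))) \<le>
        (\<Sum>x\<in>P - S. real (min (card {q\<in>A B. x \<notin> N q}) (card {q\<in>A B. x \<in> N q})))"
      proof (cases "2 \<le> card (A B)")
        case True
        have "c / 2 * (\<Sum>q\<in>{q\<in>Q - sing S. N q \<inter> S = B}. real (card (N q))) \<le>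
            c / 2 * (\<Sum>q\<in>A B. real (card (N q)))"
          using finQ \<open>c \<ge> 0\<close> by (intro mult_left_mono sum_mono2) (auto simp: A_def)
        also have "\<dots> \<le> (\<Sum>x\<in>P - S. real (min (card {q\<in>A B. x \<notin> N q}) (card {q\<in>A B. x \<in> N q})))"
        proof (rule separated_class_le[OF _ True _ \<open>c \<ge> 0\<close>])
          show "N q - N q' \<subseteq> P - S" if "q \<in> A B" "q' \<in> A B" for q q'
            using that N by (auto simp: A_def)
        qed (use finP finQ sep in \<open>auto simp: A_def\<close>)
        finally show ?thesis .
      next
        case False
        have "{q\<in>Q - sing S. N q \<inter> S = B} = {}"
        proof (rule ccontr)
          assume "\<not> ?thesis"
          then obtain q q' where "q \<in> A B" "q' \<in> A B" "q \<noteq> q'" by (auto simp: sing_def A_def)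
          moreover have "finite (A B)" using finQ by (simp add: A_def)
          ultimately have "card {q, q'} \<le> card (A B)" by (intro card_mono) auto
          then show False using False \<open>q \<noteq> q'\<close> by simp
        qed
        then show ?thesis by (simp only: sum.empty mult_zero_right) (rule sum_nonneg, simp)
      qed
    qed
    also have "\<dots> = (\<Sum>B\<in>Pow S. \<Sum>x\<in>P - S. real (min (w (insert x S) B) (w (insert x S) (insert x B))))"
    proof (intro sum.cong refl arg_cong[where f = real] arg_cong2[where f = min])
      fix B x assume "B \<in> Pow S" "x \<in> P - S"
      then have "{q\<in>A B. x \<notin> N q} = {q\<in>Q. N q \<inter> insert x S = B}"
        "{q\<in>A B. x \<in> N q} = {q\<in>Q. N q \<inter> insert x S = insert x B}"
        by (auto simp: A_def)
      then show "card {q\<in>A B. x \<notin> N q} = w (insert x S) B" "card {q\<in>A B. x \<in> N q} = w (insert x S) (insert x B)"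
        by (simp_all add: w_def)
    qed
    also have "\<dots> = real (\<Sum>x\<in>P - S. W S x)"
      unfolding W_def of_nat_sum by (rule sum.swap)
    finally show ?thesis .
  qed
  have "\<exists>S\<in>Ps r. c / 2 * (\<Sum>q\<in>Q - sing S. real (card (N q))) * real (Suc r)
      \<le> real k * real (card Q) * real (card P)"
  proof (rule ccontr)
    assume contr: "\<not> ?thesis"
    \<comment> \<open>Averaging: if every \<open>r\<close>-subset failed, the sum of the lower
      bounds over all of them would exceed the sum of the upper bounds over the
      \<open>Suc r\<close>-subsets.\<close>
    define M where "M = real k * real (card Q) * real (card P)"
    have "Ps r \<noteq> {}" unfolding Ps_def using r obtain_subset_with_card_n[of r P] by auto
    have "real (card (Ps r)) * M = (\<Sum>S\<in>Ps r. M)" by simp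
    also have "\<dots> < (\<Sum>S\<in>Ps r. real (\<Sum>x\<in>P - S. W S x) * real (Suc r))"
    proof (rule sum_strict_mono[OF finPs \<open>Ps r \<noteq> {}\<close>])
      fix S assume S: "S \<in> Ps r"
      then have "M < c / 2 * (\<Sum>q\<in>Q - sing S. real (card (N q))) * real (Suc r)"
        using contr by (auto simp: M_def not_le)
      also have "\<dots> \<le> real (\<Sum>x\<in>P - S. W S x) * real (Suc r)"
        using lower[of S] S by (intro mult_right_mono) (auto simp: Ps_def)
      finally show "M < real (\<Sum>x\<in>P - S. W S x) * real (Suc r)" .
    qed
    also have "\<dots> = real (\<Sum>S\<in>Ps r. \<Sum>x\<in>P - S. W S x) * real (Suc r)"
      by (simp only: of_nat_sum sum_distrib_right)
    also have "(\<Sum>S\<in>Ps r. \<Sum>x\<in>P - S. W S x) = (\<Sum>S\<in>Ps (Suc r). \<Sum>x\<in>S. W (S - {x}) x)"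
      unfolding Ps_def by (rule sum_subsets_remove[OF finP, symmetric])
    also have "real \<dots> * real (Suc r) \<le> real (\<Sum>S\<in>Ps (Suc r). k * card Q) * real (Suc r)"
      by (intro mult_right_mono of_nat_mono sum_mono upper) (auto simp: Ps_def)
    also have "\<dots> = real (Suc r * card (Ps (Suc r))) * real (k * card Q)" by (simp add: algebra_simps)
    also have "Suc r * card (Ps (Suc r)) = (card P - r) * card (Ps r)"
      unfolding Ps_def by (rule card_subsets_Suc[OF finP])
    also have "real \<dots> * real (k * card Q) \<le> real (card P * card (Ps r)) * real (k * card Q)"
      by (intro mult_right_mono of_nat_mono mult_le_mono1) auto
    also have "\<dots> = real (card (Ps r)) * M" by (simp add: M_def)
    finally show False by simp
  qed
  then show thesis using that unfolding sing_def Ps_def by blast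
qed

section \<open>From polynomial trace growth to the bound on the sum of cardinalities\<close>

lemma power_of_two_le_polynomial_bounded:
  obtains k where "\<And>n. 2 ^ n \<le> A * real (max 1 n) ^ d \<Longrightarrow> n \<le> k"
proof (rule that[of "max (Suc d) (nat \<lceil>A * real (Suc d) ^ Suc d\<rceil>)"], rule ccontr)
  fix n
  assume *: "2 ^ n \<le> A * real (max 1 n) ^ d" and "\<not> n \<le> max (Suc d) (nat \<lceil>A * real (Suc d) ^ Suc d\<rceil>)"
  then have n: "n > Suc d" "real n > A * real (Suc d) ^ Suc d" by (auto simp: nat_less_iff ceiling_less_iff) linarith+
  \<comment> \<open>The single coefficient \<open>n choose Suc d\<close> is below
    \<open>2 ^ n\<close> and already outgrows degree \<open>d\<close>.\<close>
  have "(real n / real (Suc d)) ^ Suc d \<le> real (n choose Suc d)"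
    using n(1) by (intro binomial_ge_n_over_k_pow_k) simp
  also have "\<dots> \<le> real (2 ^ n)" by (intro of_nat_mono binomial_le_pow2)
  also have "\<dots> \<le> A * real n ^ d" using * n(1) by (simp add: max_def)
  finally have "real n ^ Suc d / real (Suc d) ^ Suc d \<le> A * real n ^ d" by (simp only: power_divide)
  then have "real n ^ Suc d \<le> A * real n ^ d * real (Suc d) ^ Suc d"
    by (subst (asm) pos_divide_le_eq) auto
  then have "real n * real n ^ d \<le> A * real (Suc d) ^ Suc d * real n ^ d"
    by (simp only: power_Suc mult_ac)
  then have "real n \<le> A * real (Suc d) ^ Suc d" using n(1) by (simp only: mult_le_cancel_right) simp
  then show False using n(2) by simp
qed

text \<open>Injectivity is assumed separately, since \<open>separated\<close> alone would allow
  several points with empty \<open>N q\<close>.\<close>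

locale separated_set_system =
  fixes P :: "'a set" and Q :: "'b set" and N :: "'b \<Rightarrow> 'a set" and c :: real
  assumes finite_P: "finite P" and finite_Q: "finite Q"
    and N_subset: "q \<in> Q \<Longrightarrow> N q \<subseteq> P" and inj_N: "inj_on N Q"
    and separated: "q \<in> Q \<Longrightarrow> q' \<in> Q \<Longrightarrow> q \<noteq> q' \<Longrightarrow> c * real (card (N q)) \<le> real (card (N q - N q'))"
begin

lemma separated_subsystem: "R \<subseteq> Q \<Longrightarrow> separated_set_system P R N c"
  by unfold_locales
    (use finite_P finite_Q inj_N in \<open>auto intro: finite_subset inj_on_subset intro!: separated dest: N_subset\<close>)

end

lemma sum_card_le_of_trace_growth:
  assumes d: "d \<ge> 2" and "A > 0" "c > 0"
  shows "\<exists>K>0. \<forall>(P :: 'a set) (Q :: 'b set) N. separated_set_system P Q N c \<longrightarrow>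
      (\<forall>S\<subseteq>P. real (card ((\<lambda>q. N q \<inter> S) ` Q)) \<le> A * real (max 1 (card S)) ^ d) \<longrightarrow>
      (\<Sum>q\<in>Q. real (card (N q))) \<le> K * (real (card P) * real (card Q) powr (1 - 1 / real d))"
proof -
  define \<gamma> where "\<gamma> = 1 - 1 / real d"
  have \<gamma>: "\<gamma> > 0" using d by (simp add: \<gamma>_def field_simps)
  \<comment> \<open>Makes \<open>n = n powr \<gamma> * D * x\<close> for the real sample size
    \<open>x\<close> chosen below.\<close>
  define D where "D = (2 * A) powr (1 / real d)"
  have D: "D > 0" using \<open>A > 0\<close> by (simp add: D_def)
  obtain k where k: "\<And>n. 2 ^ n \<le> A * real (max 1 n) ^ d \<Longrightarrow> n \<le> k"
    using power_of_two_le_polynomial_bounded by blast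
  \<comment> \<open>The 4 joins the \<open>c / 2\<close> from \<open>sampling\<close> with the
    rounding loss \<open>x \<le> 2 * s\<close>.\<close>
  define L where "L = 4 * real k / c * D"
  define \<theta> where "\<theta> = (1 / 2) powr \<gamma>"
  have \<theta>: "\<theta> > 0" "\<theta> < 1" using \<gamma> powr_less_mono2[of \<gamma> "1/2" 1] by (auto simp: \<theta>_def)
  have L: "L \<ge> 0" using \<open>c > 0\<close> D by (simp add: L_def)
  \<comment> \<open>Solves the recursion: \<open>L\<close> for the discarded points plus
    \<open>K * \<theta>\<close> for at most half of the points must stay below \<open>K\<close>. The
    summand \<open>D\<close> covers the base case; \<open>\<theta> < 1\<close> rests on
    \<open>d \<ge> 2\<close>.\<close>
  define K where "K = L / (1 - \<theta>) + D"
  have K: "K \<ge> D" "K > 0" using L \<theta> D by (auto simp: K_def intro: add_nonneg_pos)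
  have "K * (1 - \<theta>) = L + D * (1 - \<theta>)" using \<theta> by (simp add: K_def field_simps)
  moreover have "D * (1 - \<theta>) \<ge> 0" using D \<theta> by simp
  ultimately have KL: "L + K * \<theta> \<le> K" by (simp add: right_diff_distrib)
  have "(\<Sum>q\<in>Q. real (card (N q))) \<le> K * (real (card P) * real (card Q) powr \<gamma>)"
    if "separated_set_system P Q N c"
      "\<And>S. S \<subseteq> P \<Longrightarrow> real (card ((\<lambda>q. N q \<inter> S) ` Q)) \<le> A * real (max 1 (card S)) ^ d"
    for P :: "'a set" and Q :: "'b set" and N
    using that
  proof (induction "card Q" arbitrary: Q rule: less_induct)
    case less
    interpret separated_set_system P Q N c by (rule less.prems)
    note growth = less.prems(2)
    define m where "m = card P"
    define n where "n = card Q"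
    \<comment> \<open>The solution of \<open>A * x ^ d = n / 2\<close>, so samples of at most
      \<open>x\<close> points show at most \<open>n / 2\<close> traces.\<close>
    define x where "x = (real n / (2 * A)) powr (1 / real d)"
    have cardN: "real (card (N q)) \<le> real m" if "q \<in> Q" for q
      unfolding m_def using N_subset[OF that] finite_P by (simp add: card_mono)
    have split: "real n = real n powr \<gamma> * D * x" if "n > 0"
      unfolding x_def D_def \<gamma>_def using that \<open>A > 0\<close>
      by (simp add: powr_divide powr_diff)
    show ?case
    proof (cases "n = 0 \<or> x < 1")
      case True
      have "(\<Sum>q\<in>Q. real (card (N q))) \<le> (\<Sum>q\<in>Q. real m)" by (intro sum_mono cardN)
      also have "\<dots> = real m * real n" by (simp add: n_def)
      also have "\<dots> \<le> real m * (K * real n powr \<gamma>)"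
      proof (cases "n = 0")
        case False
        then have "real n = D * real n powr \<gamma> * x" using split by (simp add: mult_ac)
        also have "\<dots> \<le> K * real n powr \<gamma> * 1"
          using True False K D by (intro mult_mono) (auto simp: x_def)
        finally show ?thesis by (intro mult_left_mono) auto
      qed simp
      finally show ?thesis by (simp add: m_def n_def mult_ac)
    next
      case False
      then have n: "n > 0" and x: "x \<ge> 1" by auto
      define s where "s = nat \<lfloor>x\<rfloor>"
      have "\<lfloor>x\<rfloor> \<ge> 1" using x by simp
      then have s: "s \<ge> 1" "real s \<le> x" "x \<le> 2 * real s" unfolding s_def by linarith+
      have "x ^ d = real n / (2 * A)"
        using n d \<open>A > 0\<close> x by (simp add: x_def powr_realpow[symmetric] powr_powr)
      then have "A * x ^ d = real n / 2" using \<open>A > 0\<close> by simp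
      moreover have "A * real s ^ d \<le> A * x ^ d"
        using \<open>A > 0\<close> s by (intro mult_left_mono power_mono) auto
      ultimately have As: "A * real s ^ d \<le> real n / 2" by simp
      have growth': "real (card ((\<lambda>q. N q \<inter> S) ` Q)) \<le> real n / 2" if "S \<subseteq> P" "card S \<le> s" for S
      proof -
        have "A * real (max 1 (card S)) ^ d \<le> A * real s ^ d"
          using \<open>A > 0\<close> s(1) that(2) by (intro mult_left_mono power_mono of_nat_mono) auto
        with growth[OF that(1)] As show ?thesis by linarith
      qed
      \<comment> \<open>By injectivity all \<open>n\<close> traces on \<open>P\<close> differ, so
        \<open>P\<close> is too large for the bound \<open>n / 2\<close>.\<close>
      have "s \<le> m"
      proof (rule ccontr)
        assume "\<not> s \<le> m"
        then have "real (card ((\<lambda>q. N q \<inter> P) ` Q)) \<le> real n / 2" by (intro growth') (auto simp: m_def)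
        moreover have "(\<lambda>q. N q \<inter> P) ` Q = N ` Q" using N_subset by (intro image_cong) auto
        ultimately show False using inj_N n by (simp add: card_image n_def)
      qed
      have VC: "card T \<le> k" if T: "T \<subseteq> P" "shatters (N ` Q) T" for T
      proof (rule k)
        have "Pow T \<subseteq> (\<lambda>q. N q \<inter> T) ` Q" using T(2) by (auto simp: shatters_def)
        then have "card (Pow T) \<le> card ((\<lambda>q. N q \<inter> T) ` Q)" using finite_Q by (intro card_mono) auto
        moreover have "2 ^ card T = real (card (Pow T))" using finite_subset[OF T(1) finite_P] by (simp add: card_Pow)
        ultimately have "2 ^ card T \<le> real (card ((\<lambda>q. N q \<inter> T) ` Q))" by simp
        also note growth[OF T(1)]
        finally show "2 ^ card T \<le> A * real (max 1 (card T)) ^ d" .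
      qed
      have "c \<ge> 0" "s - 1 \<le> card P" using \<open>c > 0\<close> \<open>s \<le> m\<close> by (auto simp: m_def)
      \<comment> \<open>With \<open>s - 1\<close> sample points the factor \<open>Suc r\<close> of
        \<open>sampling\<close> is exactly \<open>s\<close>.\<close>
      obtain S where S: "S \<subseteq> P" "card S = s - 1"
        "c / 2 * (\<Sum>q\<in>Q - {q\<in>Q. \<forall>q'\<in>Q. N q' \<inter> S = N q \<inter> S \<longrightarrow> q' = q}. real (card (N q))) * real (Suc (s - 1))
          \<le> real k * real (card Q) * real (card P)"
        by (rule sampling[where N = N, OF finite_P finite_Q N_subset \<open>c \<ge> 0\<close> separated VC \<open>s - 1 \<le> card P\<close>]) (assumption | rule that)+
      define R where "R = {q\<in>Q. \<forall>q'\<in>Q. N q' \<inter> S = N q \<inter> S \<longrightarrow> q' = q}"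
      have "R \<subseteq> Q" "finite R" using finite_Q by (auto simp: R_def)
      have "inj_on (\<lambda>q. N q \<inter> S) R" by (auto simp: R_def inj_on_def)
      then have "card R = card ((\<lambda>q. N q \<inter> S) ` R)" by (simp add: card_image)
      also have "\<dots> \<le> card ((\<lambda>q. N q \<inter> S) ` Q)" using \<open>R \<subseteq> Q\<close> finite_Q by (intro card_mono) auto
      finally have R: "real (card R) \<le> real n / 2" using growth'[OF S(1)] S(2) by linarith
      have "(\<Sum>q\<in>R. real (card (N q))) \<le> K * (real (card P) * real (card R) powr \<gamma>)"
      proof (rule less.hyps[OF _ separated_subsystem[OF \<open>R \<subseteq> Q\<close>]])
        show "card R < card Q" using R n by (simp add: n_def)
        show "real (card ((\<lambda>q. N q \<inter> S) ` R)) \<le> A * real (max 1 (card S)) ^ d" if "S \<subseteq> P" for S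
          using card_mono[OF finite_imageI[OF finite_Q] image_mono[OF \<open>R \<subseteq> Q\<close>], of "\<lambda>q. N q \<inter> S"] growth[OF that]
          by linarith
      qed
      also have "\<dots> \<le> K * (real m * (real n / 2) powr \<gamma>)"
        unfolding m_def using R K(2) \<gamma> by (intro mult_left_mono powr_mono2) auto
      also have "\<dots> = K * \<theta> * (real m * real n powr \<gamma>)" by (simp add: \<theta>_def powr_divide)
      finally have 1: "(\<Sum>q\<in>R. real (card (N q))) \<le> K * \<theta> * (real m * real n powr \<gamma>)" .
      have "(\<Sum>q\<in>Q - R. real (card (N q))) \<le> L * (real m * real n powr \<gamma>)"
      proof -
        define I where "I = (\<Sum>q\<in>Q - R. real (card (N q)))"
        have "I \<ge> 0" unfolding I_def by (intro sum_nonneg) auto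
        have "c / 4 * I * x \<le> c / 4 * I * (2 * real s)"
          using s \<open>c > 0\<close> \<open>I \<ge> 0\<close> by (intro mult_left_mono) auto
        also have "\<dots> = c / 2 * I * real s" by simp
        also have "\<dots> \<le> real k * real n * real m"
          using S(3) s(1) unfolding R_def[symmetric] I_def n_def m_def by simp
        also have "\<dots> = real k * (real n powr \<gamma> * D) * real m * x"
          by (subst split[OF n]) simp
        finally have "c / 4 * I \<le> real k * (real n powr \<gamma> * D) * real m" using x by simp
        then show ?thesis using \<open>c > 0\<close> by (simp add: L_def I_def field_simps)
      qed
      with 1 have "(\<Sum>q\<in>Q. real (card (N q))) \<le> (L + K * \<theta>) * (real m * real n powr \<gamma>)"
        using sum.subset_diff[OF \<open>R \<subseteq> Q\<close> finite_Q, of "\<lambda>q. real (card (N q))"] by (simp add: distrib_right)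
      also have "\<dots> \<le> K * (real m * real n powr \<gamma>)" by (intro mult_right_mono KL) auto
      finally show ?thesis by (simp add: m_def n_def)
    qed
  qed
  with K(2) show ?thesis unfolding \<gamma>_def by (intro exI[of _ K]) simp
qed

section \<open>Sign changes on a line\<close>

text \<open>Every sign change gives a zero of a perturbed function \<open>G\<close> strictly between
  \<open>x\<close> and its successor \<open>nxt x\<close>. These gaps are disjoint, so the zeros are
  distinct, and \<open>card_common_zeros_le\<close> in dimension one bounds their number.\<close>

lemma card_sign_changes_le:
  fixes g :: "real ^ 'n \<Rightarrow> real"
  assumes n1: "CARD('n) = 1" and g: "polyfun_le t g" and "finite X" "Y \<subseteq> X"
    and nxt: "\<And>x. x \<in> Y \<Longrightarrow> nxt x \<in> X" "\<And>x. x \<in> Y \<Longrightarrow> x $ i < nxt x $ i"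
      "\<And>x z. x \<in> Y \<Longrightarrow> z \<in> X \<Longrightarrow> x $ i < z $ i \<Longrightarrow> nxt x $ i \<le> z $ i"
  shows "card {x\<in>Y. (g x \<ge> 0) \<noteq> (g (nxt x) \<ge> 0)} \<le> Suc t"
proof -
  have UNIV_i: "UNIV = {i}" using n1 by (metis UNIV_I card_1_singletonE singletonD)
  then have all_i: "j = i" for j by auto
  have vec_i: "vec (x $ i) = x" for x :: "real ^ 'n" using all_i by (metis vec_component vec_eq_iff)
  obtain \<epsilon> where \<epsilon>: "\<epsilon> > 0" "\<And>x. x \<in> {x\<in>X. g x < 0} \<Longrightarrow> \<epsilon> * 1 < - g x"
    by (rule finite_uniform_gap[of "{x\<in>X. g x < 0}" "\<lambda>x. - g x" "\<lambda>_. 1"]) (use \<open>finite X\<close> in auto)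
  have g\<epsilon>: "g x \<ge> 0 \<longleftrightarrow> g x + \<epsilon> > 0" "g x + \<epsilon> \<noteq> 0" if "x \<in> X" for x
    using \<epsilon>(1) \<epsilon>(2)[of x] that by (cases "g x < 0"; force)+
  obtain \<eta> where \<eta>: "\<eta> > 0" "\<And>x. x \<in> X \<Longrightarrow> \<eta> * \<bar>(x $ i) ^ Suc t\<bar> < \<bar>g x + \<epsilon>\<bar>"
    by (rule finite_uniform_gap[of X "\<lambda>x. \<bar>g x + \<epsilon>\<bar>" "\<lambda>x. \<bar>(x $ i) ^ Suc t\<bar>"])
      (use \<open>finite X\<close> g\<epsilon> in auto)
  \<comment> \<open>The shift by \<open>\<epsilon>\<close> removes zeros on \<open>X\<close>. The
    small term of exponent \<open>Suc t\<close> keeps the signs there and brings the equation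
    \<open>G x = 0\<close> into the form that the zero count requires, whatever \<open>g\<close>
    is.\<close>
  define G where "G = (\<lambda>x. g x + \<epsilon> - \<eta> * (x $ i) ^ Suc t)"
  have G: "g x \<ge> 0 \<longleftrightarrow> G x > 0" "G x \<noteq> 0" if "x \<in> X" for x
  proof -
    have "\<bar>\<eta> * (x $ i) ^ Suc t\<bar> < \<bar>g x + \<epsilon>\<bar>" using \<eta>(1) \<eta>(2)[OF that] by (simp add: abs_mult)
    then show "g x \<ge> 0 \<longleftrightarrow> G x > 0" "G x \<noteq> 0" unfolding g\<epsilon>(1)[OF that] G_def by linarith+
  qed
  have cont: "continuous_on S (\<lambda>s. G (vec s))" for S
  proof -
    have "continuous_on (range vec) G"
      unfolding G_def by (intro continuous_intros continuous_on_polyfun_le[OF g])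
    moreover have "continuous_on S (vec :: real \<Rightarrow> real ^ 'n)"
      unfolding vec_def by (intro continuous_intros)
    ultimately show ?thesis by (auto intro: continuous_on_compose2)
  qed
  define Ch where "Ch = {x\<in>Y. (g x \<ge> 0) \<noteq> (g (nxt x) \<ge> 0)}"
  have "\<exists>z. x $ i < z $ i \<and> z $ i < nxt x $ i \<and> G z = 0" if "x \<in> Ch" for x
  proof -
    have x: "x \<in> Y" "x \<in> X" "nxt x \<in> X" using that nxt(1) \<open>Y \<subseteq> X\<close> by (auto simp: Ch_def)
    have ne: "(G x > 0) \<noteq> (G (nxt x) > 0)" using that x G by (simp add: Ch_def)
    have "\<exists>s\<ge>x $ i. s \<le> nxt x $ i \<and> G (vec s) = 0"
    proof (cases "G x > 0")
      case True
      then show ?thesis using IVT2'[of "\<lambda>s. G (vec s)" "nxt x $ i" 0 "x $ i"] cont ne nxt(2)[OF x(1)]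
        by (auto simp: vec_i)
    next
      case False
      then show ?thesis using IVT'[of "\<lambda>s. G (vec s)" "x $ i" 0 "nxt x $ i"] cont ne nxt(2)[OF x(1)]
        by (auto simp: vec_i)
    qed
    then obtain s where s: "s \<ge> x $ i" "s \<le> nxt x $ i" "G (vec s) = 0" by blast
    then have "s \<noteq> x $ i" "s \<noteq> nxt x $ i" using G(2) x vec_i by metis+
    then show ?thesis using s by (intro exI[of _ "vec s"]) auto
  qed
  then obtain w where w: "\<And>x. x \<in> Ch \<Longrightarrow> x $ i < w x $ i" "\<And>x. x \<in> Ch \<Longrightarrow> w x $ i < nxt x $ i"
    "\<And>x. x \<in> Ch \<Longrightarrow> G (w x) = 0" by metis
  have w_less: "w x $ i < w y $ i" if "x \<in> Ch" "y \<in> Ch" "x $ i < y $ i" for x y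
  proof -
    have "nxt x $ i \<le> y $ i" using that \<open>Y \<subseteq> X\<close> by (intro nxt(3)) (auto simp: Ch_def)
    then show ?thesis using w(2)[OF that(1)] w(1)[OF that(2)] by linarith
  qed
  have "inj_on w Ch"
  proof (rule inj_onI)
    fix x y assume "x \<in> Ch" "y \<in> Ch" "w x = w y"
    then have "x $ i = y $ i" using w_less[of x y] w_less[of y x] by (cases "x $ i" "y $ i" rule: linorder_cases) auto
    then show "x = y" using vec_i by metis
  qed
  then have "card Ch = card (w ` Ch)" by (simp add: card_image)
  also have "\<dots> \<le> Suc t ^ CARD('n)"
  proof (rule card_common_zeros_le)
    show "finite (w ` Ch)" using finite_subset[OF \<open>Y \<subseteq> X\<close> \<open>finite X\<close>] by (simp add: Ch_def)
    show "polyfun_le t (\<lambda>x. 1 / \<eta> * (g x + \<epsilon>))" for j :: 'n by (intro polyfun_le_cmult polyfun_le.add g polyfun_le.const)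
    show "(z $ j) ^ Suc t = 1 / \<eta> * (g z + \<epsilon>)" if "z \<in> w ` Ch" for z j
      using that w(3) \<eta>(1) all_i[of j] by (auto simp: G_def field_simps)
  qed
  finally show ?thesis by (simp add: n1 Ch_def)
qed

section \<open>Semi-algebraic graphs\<close>

text \<open>\<open>signs_determine\<close> is what remains of the Boolean function: membership of
  \<open>p\<close> depends on the signs at \<open>q\<close> alone.\<close>

locale separated_sign_system = separated_set_system P Q N c
  for P :: "'a set" and Q :: "(real ^ 'n) set" and N c +
  fixes f :: "nat \<Rightarrow> 'a \<Rightarrow> real ^ 'n \<Rightarrow> real" and t :: nat
  assumes polyfun_le_f: "j < t \<Longrightarrow> p \<in> P \<Longrightarrow> polyfun_le t (f j p)"
    and signs_determine: "p \<in> P \<Longrightarrow> q \<in> Q \<Longrightarrow> q' \<in> Q \<Longrightarrow>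
        \<forall>j<t. (f j p q \<ge> 0) = (f j p q' \<ge> 0) \<Longrightarrow> p \<in> N q \<longleftrightarrow> p \<in> N q'"
begin

lemma card_traces_le:
  assumes S: "S \<subseteq> P"
  shows "real (card ((\<lambda>q. N q \<inter> S) ` Q)) \<le>
    2 * real (2 * t ^ 2 + 1) ^ CARD('n) * real (max 1 (card S)) ^ CARD('n)"
proof -
  define pat where "pat = (\<lambda>q. {e \<in> S \<times> {..<t}. f (snd e) (fst e) q \<ge> 0})"
  have fin: "finite S" using S finite_P finite_subset by blast
  have "N q \<inter> S = N q' \<inter> S" if "q \<in> Q" "q' \<in> Q" "pat q = pat q'" for q q'
  proof -
    have "\<forall>j<t. (f j p q \<ge> 0) = (f j p q' \<ge> 0)" if "p \<in> S" for p
      using \<open>pat q = pat q'\<close> that by (auto simp: pat_def set_eq_iff)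
    then show ?thesis using signs_determine[OF _ that(1,2)] S by blast
  qed
  \<comment> \<open>One representative per sign pattern exhibits the traces as an image of the
    patterns.\<close>
  then have "N (inv_into Q pat (pat q)) \<inter> S = N q \<inter> S" if "q \<in> Q" for q
    using that by (metis f_inv_into_f imageI inv_into_into)
  then have "(\<lambda>q. N q \<inter> S) ` Q = (\<lambda>D. N (inv_into Q pat D) \<inter> S) ` pat ` Q"
    unfolding image_image by (intro image_cong) auto
  then have "card ((\<lambda>q. N q \<inter> S) ` Q) \<le> card (pat ` Q)" using finite_Q by (simp add: card_image_le)
  also have "\<dots> \<le> 2 * Suc (2 * (card (S \<times> {..<t}) * t)) ^ CARD('n)"
    unfolding pat_def using fin finite_Q S polyfun_le_f by (intro card_sign_patterns_le) auto
  also have "\<dots> \<le> 2 * ((2 * t ^ 2 + 1) * max 1 (card S)) ^ CARD('n)"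
  proof (intro mult_left_mono power_mono)
    have "Suc (2 * (card (S \<times> {..<t}) * t)) = 2 * t ^ 2 * card S + 1"
      by (simp add: power2_eq_square card_cartesian_product)
    also have "\<dots> \<le> 2 * t ^ 2 * max 1 (card S) + max 1 (card S)"
      by (intro add_mono mult_left_mono) auto
    finally show "Suc (2 * (card (S \<times> {..<t}) * t)) \<le> (2 * t ^ 2 + 1) * max 1 (card S)"
      by (simp only: distrib_right mult_1)
  qed auto
  finally have "real (card ((\<lambda>q. N q \<inter> S) ` Q)) \<le> real (2 * ((2 * t ^ 2 + 1) * max 1 (card S)) ^ CARD('n))"
    by (rule of_nat_mono)
  also have "\<dots> = 2 * real (2 * t ^ 2 + 1) ^ CARD('n) * real (max 1 (card S)) ^ CARD('n)"
    by (simp only: power_mult_distrib of_nat_mult of_nat_power of_nat_numeral mult.assoc)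
  finally show ?thesis .
qed

text \<open>Along the ordered \<open>Q\<close>, each of the \<open>t\<close> functions of a point
  \<open>p\<close> changes sign at most \<open>Suc t\<close> times, so \<open>p\<close> leaves the
  sets at most \<open>t * Suc t\<close> times. The rightmost point has no successor and accounts for
  the \<open>+ 1\<close>.\<close>

lemma sum_card_le_of_line:
  assumes n1: "CARD('n) = 1" and "c > 0"
  shows "(\<Sum>q\<in>Q. real (card (N q))) \<le> (real (t * Suc t) / c + 1) * real (card P)"
proof (cases "Q = {}")
  case True
  then show ?thesis using \<open>c > 0\<close> by simp
next
  case False
  define i :: 'n where "i = undefined"
  have UNIV_i: "UNIV = {i}" using n1 by (metis UNIV_I card_1_singletonE singletonD)
  have eq_i: "x = y" if "x $ i = y $ i" for x y :: "real ^ 'n"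
    unfolding vec_eq_iff using that UNIV_i by (metis UNIV_I singletonD)
  obtain l where l: "l \<in> Q" "\<And>q. q \<in> Q \<Longrightarrow> q $ i \<le> l $ i"
  proof -
    have "Max ((\<lambda>q. q $ i) ` Q) \<in> (\<lambda>q. q $ i) ` Q" using finite_Q False by (intro Max_in) auto
    then obtain l where "l \<in> Q" "l $ i = Max ((\<lambda>q. q $ i) ` Q)" by auto
    then show thesis using finite_Q by (intro that[of l]) auto
  qed
  define Y where "Y = Q - {l}"
  have Y: "Y \<subseteq> Q" "finite Y" using finite_Q by (auto simp: Y_def)
  have "\<exists>y. y \<in> Q \<and> x $ i < y $ i \<and> (\<forall>z\<in>Q. x $ i < z $ i \<longrightarrow> y $ i \<le> z $ i)" if "x \<in> Y" for x
  proof -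
    define Z where "Z = {z\<in>Q. x $ i < z $ i}"
    have "x $ i \<le> l $ i" "x \<noteq> l" using that l by (auto simp: Y_def)
    then have "x $ i < l $ i" using eq_i[of x l] by linarith
    then have Z: "finite Z" "Z \<noteq> {}" using l(1) finite_Q by (auto simp: Z_def)
    then have "Min ((\<lambda>q. q $ i) ` Z) \<in> (\<lambda>q. q $ i) ` Z" by (intro Min_in) auto
    then obtain y where "y \<in> Z" "y $ i = Min ((\<lambda>q. q $ i) ` Z)" by auto
    then show ?thesis using Z by (intro exI[of _ y]) (auto simp: Z_def)
  qed
  then obtain nxt where nxt: "\<And>x. x \<in> Y \<Longrightarrow> nxt x \<in> Q" "\<And>x. x \<in> Y \<Longrightarrow> x $ i < nxt x $ i"
    "\<And>x z. x \<in> Y \<Longrightarrow> z \<in> Q \<Longrightarrow> x $ i < z $ i \<Longrightarrow> nxt x $ i \<le> z $ i" by metis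
  have "c * (\<Sum>q\<in>Y. real (card (N q))) = (\<Sum>q\<in>Y. c * real (card (N q)))" by (simp add: sum_distrib_left)
  also have "\<dots> \<le> (\<Sum>q\<in>Y. real (card (N q - N (nxt q))))"
    using nxt(1,2) Y by (intro sum_mono separated) force+
  also have "\<dots> = real (\<Sum>q\<in>Y. card {p\<in>P. p \<in> N q - N (nxt q)})"
    unfolding of_nat_sum
  proof (intro sum.cong refl)
    fix q assume "q \<in> Y"
    then have "N q - N (nxt q) = {p\<in>P. p \<in> N q - N (nxt q)}" using N_subset Y(1) by blast
    then show "real (card (N q - N (nxt q))) = real (card {p\<in>P. p \<in> N q - N (nxt q)})" by simp
  qed
  also have "(\<Sum>q\<in>Y. card {p\<in>P. p \<in> N q - N (nxt q)}) = (\<Sum>p\<in>P. card {q\<in>Y. p \<in> N q - N (nxt q)})"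
    using Y(2) finite_P by (rule sum_card_swap)
  also have "\<dots> \<le> (\<Sum>p\<in>P. t * Suc t)"
  proof (rule sum_mono)
    fix p assume p: "p \<in> P"
    have "{q\<in>Y. p \<in> N q - N (nxt q)} \<subseteq> (\<Union>j\<in>{..<t}. {q\<in>Y. (f j p q \<ge> 0) \<noteq> (f j p (nxt q) \<ge> 0)})"
    proof
      fix q assume "q \<in> {q\<in>Y. p \<in> N q - N (nxt q)}"
      then show "q \<in> (\<Union>j\<in>{..<t}. {q\<in>Y. (f j p q \<ge> 0) \<noteq> (f j p (nxt q) \<ge> 0)})"
        using signs_determine[OF p, of q "nxt q"] nxt(1)[of q] Y(1) by auto
    qed
    then have "card {q\<in>Y. p \<in> N q - N (nxt q)} \<le> card (\<Union>j\<in>{..<t}. {q\<in>Y. (f j p q \<ge> 0) \<noteq> (f j p (nxt q) \<ge> 0)})"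
      using Y(2) by (intro card_mono) auto
    also have "\<dots> \<le> (\<Sum>j\<in>{..<t}. card {q\<in>Y. (f j p q \<ge> 0) \<noteq> (f j p (nxt q) \<ge> 0)})"
      by (rule card_UN_le) simp
    also have "\<dots> \<le> (\<Sum>j\<in>{..<t}. Suc t)"
      by (intro sum_mono card_sign_changes_le[OF n1 polyfun_le_f finite_Q Y(1) nxt]) (use p in auto)
    finally show "card {q\<in>Y. p \<in> N q - N (nxt q)} \<le> t * Suc t" by simp
  qed
  finally have "c * (\<Sum>q\<in>Y. real (card (N q))) \<le> real (card P * (t * Suc t))" by simp
  then have "(\<Sum>q\<in>Y. real (card (N q))) \<le> real (t * Suc t) / c * real (card P)"
    using \<open>c > 0\<close> by (simp add: field_simps)
  moreover have "card (N l) \<le> card P" using N_subset[OF l(1)] finite_P by (rule card_mono[rotated])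
  moreover have "(\<Sum>q\<in>Q. real (card (N q))) = real (card (N l)) + (\<Sum>q\<in>Y. real (card (N q)))"
    unfolding Y_def using finite_Q l(1) by (rule sum.remove)
  ultimately show ?thesis by (simp add: distrib_right)
qed

end

section \<open>Combining the two cases and passing to semi-algebraic graphs\<close>

lemma separated_sign_system_sum_card_le:
  assumes "c > 0"
  shows "\<exists>K>0. \<forall>(P :: 'a set) (Q :: (real ^ 'n) set) N f. separated_sign_system P Q N c f t \<longrightarrow>
    (\<Sum>q\<in>Q. real (card (N q))) \<le> K * (real (card P) * real (card Q) powr (1 - 1 / real CARD('n)))"
proof (cases "CARD('n) = 1")
  case True
  define K where "K = real (t * Suc t) / c + 1"
  have "K > 0" using \<open>c > 0\<close> by (auto simp: K_def intro!: add_nonneg_pos)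
  moreover have "(\<Sum>q\<in>Q. real (card (N q))) \<le> K * (real (card P) * real (card Q) powr (1 - 1 / real CARD('n)))"
    if "separated_sign_system P Q N c f t" for P :: "'a set" and Q :: "(real ^ 'n) set" and N f
  \<comment> \<open>The exponent is 0 here: \<open>powr\<close> yields 1 for nonempty
    \<open>Q\<close>, while base 0 yields 0 and matches the empty sum.\<close>
  proof (cases "Q = {}")
    case False
    interpret separated_sign_system P Q N c f t by (rule that)
    have "card Q > 0" using False finite_Q by (simp add: card_gt_0_iff)
    then show ?thesis using sum_card_le_of_line[OF True \<open>c > 0\<close>] True by (simp add: K_def)
  qed simp
  ultimately show ?thesis by blast
next
  case False
  moreover have "CARD('n) > 0" by simp
  ultimately have d: "CARD('n) \<ge> 2" by linarith
  define A where "A = 2 * real (2 * t ^ 2 + 1) ^ CARD('n)"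
  have "A > 0" by (simp add: A_def add_pos_nonneg)
  from sum_card_le_of_trace_growth[OF d this \<open>c > 0\<close>, where 'a = 'a and 'b = "real ^ 'n"]
  obtain K where K: "K > 0" "\<forall>(P :: 'a set) (Q :: (real ^ 'n) set) N. separated_set_system P Q N c \<longrightarrow>
      (\<forall>S\<subseteq>P. real (card ((\<lambda>q. N q \<inter> S) ` Q)) \<le> A * real (max 1 (card S)) ^ CARD('n)) \<longrightarrow>
      (\<Sum>q\<in>Q. real (card (N q))) \<le> K * (real (card P) * real (card Q) powr (1 - 1 / real CARD('n)))"
    by (elim exE conjE)
  have "(\<Sum>q\<in>Q. real (card (N q))) \<le> K * (real (card P) * real (card Q) powr (1 - 1 / real CARD('n)))"
    if "separated_sign_system P Q N c f t" for P :: "'a set" and Q :: "(real ^ 'n) set" and N f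
  proof -
    interpret separated_sign_system P Q N c f t by (rule that)
    show ?thesis
      by (rule K(2)[rule_format, OF separated_set_system_axioms]) (use card_traces_le in \<open>simp only: A_def\<close>)
  qed
  with K(1) show ?thesis by blast
qed

theorem theorem1p5:
  fixes \<beta> :: real and t :: nat
  assumes "t > 0" and "0 < \<beta>" and "\<beta> < 1"
  shows "\<exists>C::real. C > 0 \<and>
    (\<forall>(m::nat) (n::nat) (P :: (real ^ 'd1) set) (Q :: (real ^ 'd2) set) (E :: ((real ^ 'd1) \<times> (real ^ 'd2)) set).
       finite P \<and> card P = m \<and> finite Q \<and> card Q = n \<and> E \<subseteq> P \<times> Q \<and>
       semi_algebraic_graph t P Q E \<and> nondegenerate \<beta> Q E \<longrightarrow>
       real (card E) \<le> C * (real m * real n powr (1 - 1 / real CARD('d2)) + real n))"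
proof -
  define c where "c = 1 - \<beta>"
  have c: "c > 0" using \<open>\<beta> < 1\<close> by (simp add: c_def)
  from separated_sign_system_sum_card_le[OF c, where 'a = "real ^ 'd1" and 'n = 'd2 and t = t]
  obtain K where K: "K > 0" "\<forall>(P :: (real ^ 'd1) set) (Q :: (real ^ 'd2) set) N f. separated_sign_system P Q N c f t \<longrightarrow>
      (\<Sum>q\<in>Q. real (card (N q))) \<le> K * (real (card P) * real (card Q) powr (1 - 1 / real CARD('d2)))"
    by (elim exE conjE)
  have "real (card E) \<le> K * (real m * real n powr (1 - 1 / real CARD('d2)) + real n)"
    if "finite P" "card P = m" "finite Q" "card Q = n" and E: "E \<subseteq> P \<times> Q"
      and semi: "semi_algebraic_graph t P Q E" and nd: "nondegenerate \<beta> Q E"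
    for m n :: nat and P :: "(real ^ 'd1) set" and Q :: "(real ^ 'd2) set" and E
  proof -
    define N where "N = neighborhood E"
    have NP: "N q \<subseteq> P" for q using E by (auto simp: N_def neighborhood_def)
    have nd': "real (card (N q \<inter> N q')) < \<beta> * real (card (N q))" if "q \<in> Q" "q' \<in> Q" "q \<noteq> q'" for q q'
      using nd that unfolding N_def nondegenerate_def by blast
    \<comment> \<open>The strict inequality in nondegeneracy excludes equal neighborhoods even when
      they are empty.\<close>
    have inj: "inj_on N Q"
    proof (rule inj_onI, rule ccontr)
      fix q q' assume "q \<in> Q" "q' \<in> Q" "N q = N q'" "q \<noteq> q'"
      then have "real (card (N q)) < \<beta> * real (card (N q))" using nd'[of q q'] by simp
      also have "\<dots> \<le> 1 * real (card (N q))" using \<open>\<beta> < 1\<close> by (intro mult_right_mono) auto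
      finally show False by simp
    qed
    have sep: "c * real (card (N q)) \<le> real (card (N q - N q'))" if "q \<in> Q" "q' \<in> Q" "q \<noteq> q'" for q q'
    proof -
      have "finite (N q)" using NP \<open>finite P\<close> finite_subset by blast
      then have "card (N q) = card (N q \<inter> N q') + card (N q - N q')" by (rule card_Int_Diff)
      then show ?thesis using nd'[OF that] by (simp add: c_def left_diff_distrib)
    qed
    obtain fs :: "('d1 + 'd2) real_mpoly list" and \<Phi> where fs: "length fs = t"
      "\<And>f. f \<in> set fs \<Longrightarrow> degree_at_most t f"
      "\<And>p q. p \<in> P \<Longrightarrow> q \<in> Q \<Longrightarrow> (p, q) \<in> E \<longleftrightarrow> \<Phi> (map (\<lambda>f. eval_mpoly f (join_point p q) \<ge> 0) fs)"
      using semi unfolding semi_algebraic_graph_def by blast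
    define f where "f = (\<lambda>j p q. eval_mpoly (fs ! j) (join_point p q))"
    have polf: "polyfun_le t (f j p)" if "j < t" for j p
      unfolding f_def using fs(1,2) that by (intro polyfun_le_eval_mpoly) simp
    have det: "p \<in> N q \<longleftrightarrow> p \<in> N q'"
      if "p \<in> P" "q \<in> Q" "q' \<in> Q" "\<forall>j<t. (f j p q \<ge> 0) = (f j p q' \<ge> 0)" for p q q'
    proof -
      have "map (\<lambda>f. eval_mpoly f (join_point p q) \<ge> 0) fs = map (\<lambda>f. eval_mpoly f (join_point p q') \<ge> 0) fs"
        using that(4) fs(1) by (intro nth_equalityI) (auto simp: f_def)
      then show ?thesis
        using fs(3)[OF that(1,2)] fs(3)[OF that(1,3)] by (simp only: N_def neighborhood_def mem_Collect_eq)
    qed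
    have "separated_sign_system P Q N c f t"
      by unfold_locales (assumption | rule \<open>finite P\<close> \<open>finite Q\<close> NP inj sep polf det)+
    then have "(\<Sum>q\<in>Q. real (card (N q))) \<le>
        K * (real (card P) * real (card Q) powr (1 - 1 / real CARD('d2)))"
      using K(2) by blast
    moreover have "card E = (\<Sum>q\<in>Q. card (N q))"
    proof -
      have "finite (N q)" for q using NP \<open>finite P\<close> finite_subset by blast
      then have "card (SIGMA q:Q. N q) = (\<Sum>q\<in>Q. card (N q))" using \<open>finite Q\<close> by simp
      moreover have "E\<inverse> = (SIGMA q:Q. N q)" using E by (auto simp: N_def neighborhood_def)
      moreover have "card (E\<inverse>) = card E" by (rule card_inverse)
      ultimately show ?thesis by simp
    qed
    ultimately have "real (card E) \<le> K * (real m * real n powr (1 - 1 / real CARD('d2)))"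
      using \<open>card P = m\<close> \<open>card Q = n\<close> by simp
    also have "\<dots> \<le> K * (real m * real n powr (1 - 1 / real CARD('d2)) + real n)"
      using K(1) by (intro mult_left_mono) auto
    finally show ?thesis .
  qed
  with K(1) show ?thesis by (intro exI[of _ K]) blast
qed

end
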